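(* Let $G$ be an $\widetilde{\mathfrak M}_c$-group. Then the Fitting subgroup of $G$ is nilpotent.
   Context: $G$ is a group, possibly equipped with additional first-order structure; "definable" means definable with parameters in this structure. For definable subgroups $H,N$ of $G$ with $N$ normalized by $H$, write $H/N$ for $H/(H\cap N)$ and, for $g_0,\dots,g_m\in H$, $C_{H/N}(g_0N,\dots,g_mN)$ for the centralizer in $H/N$ of these cosets. $G$ is an $\widetilde{\mathfrak M}_c$-group if for any two definable subgroups $H$ and $N$ of $G$ with $N$ normalized by $H$ there are natural numbers $n_{HN}$ and $d_{HN}$ such that every chain $C_{H/N}(g_0N)\geq C_{H/N}(g_0N,g_1N)\geq\cdots\geq C_{H/N}(g_0N,\dots,g_mN)\geq\cdots$ in which each group has index at least $d_{HN}$ in its predecessor has length at most $n_{HN}$. The Fitting subgroup of $G$ is the subgroup generated by all normal nilpotent subgroups of $G$. *)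

theory Defs
  imports "HOL-Algebra.Algebra"
begin

section \<open>Groups with additional first-order structure\<close>

text \<open>
  A symbol is paired with its arity; the signature of the additional structure is a set of
  such pairs, so both sets are empty for a pure group. Constants are nullary functions.
\<close>

record ('a, 'f, 'r) expanded_group = "'a monoid" +
  fun_sig :: "('f \<times> nat) set"
  fun_interp :: "'f \<Rightarrow> 'a list \<Rightarrow> 'a"
  rel_sig :: "('r \<times> nat) set"
  rel_interp :: "'r \<Rightarrow> 'a list \<Rightarrow> bool"

locale expanded_group = group G for G :: "('a, 'f, 'r, 'z) expanded_group_scheme" (structure) +
  assumes fun_interp_closed:
    "(f, length xs) \<in> fun_sig G \<Longrightarrow> set xs \<subseteq> carrier G \<Longrightarrow> fun_interp G f xs \<in> carrier G"

datatype 'f fo_term =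
    Var nat
  | One
  | Inverse "'f fo_term"
  | Times "'f fo_term" "'f fo_term"
  | Fun 'f "'f fo_term list"

datatype ('f, 'r) fo_formula =
    Equal "'f fo_term" "'f fo_term"
  | Rel 'r "'f fo_term list"
  | Neg "('f, 'r) fo_formula"
  | Conj "('f, 'r) fo_formula" "('f, 'r) fo_formula"
  | Exists nat "('f, 'r) fo_formula"

fun wf_term :: "('a, 'f, 'r, 'z) expanded_group_scheme \<Rightarrow> 'f fo_term \<Rightarrow> bool" where
  "wf_term G (Var i) = True"
| "wf_term G One = True"
| "wf_term G (Inverse t) = wf_term G t"
| "wf_term G (Times s t) = (wf_term G s \<and> wf_term G t)"
| "wf_term G (Fun f ts) = ((f, length ts) \<in> fun_sig G \<and> (\<forall>t\<in>set ts. wf_term G t))"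

fun wf_formula :: "('a, 'f, 'r, 'z) expanded_group_scheme \<Rightarrow> ('f, 'r) fo_formula \<Rightarrow> bool" where
  "wf_formula G (Equal s t) = (wf_term G s \<and> wf_term G t)"
| "wf_formula G (Rel r ts) = ((r, length ts) \<in> rel_sig G \<and> (\<forall>t\<in>set ts. wf_term G t))"
| "wf_formula G (Neg p) = wf_formula G p"
| "wf_formula G (Conj p q) = (wf_formula G p \<and> wf_formula G q)"
| "wf_formula G (Exists i p) = wf_formula G p"

fun eval_term ::
  "('a, 'f, 'r, 'z) expanded_group_scheme \<Rightarrow> (nat \<Rightarrow> 'a) \<Rightarrow> 'f fo_term \<Rightarrow> 'a" where
  "eval_term G e (Var i) = e i"
| "eval_term G e One = \<one>\<^bsub>G\<^esub>"
| "eval_term G e (Inverse t) = inv\<^bsub>G\<^esub> (eval_term G e t)"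
| "eval_term G e (Times s t) = eval_term G e s \<otimes>\<^bsub>G\<^esub> eval_term G e t"
| "eval_term G e (Fun f ts) = fun_interp G f (map (eval_term G e) ts)"

fun sat ::
  "('a, 'f, 'r, 'z) expanded_group_scheme \<Rightarrow> (nat \<Rightarrow> 'a) \<Rightarrow> ('f, 'r) fo_formula \<Rightarrow> bool" where
  "sat G e (Equal s t) = (eval_term G e s = eval_term G e t)"
| "sat G e (Rel r ts) = rel_interp G r (map (eval_term G e) ts)"
| "sat G e (Neg p) = (\<not> sat G e p)"
| "sat G e (Conj p q) = (sat G e p \<and> sat G e q)"
| "sat G e (Exists i p) = (\<exists>a\<in>carrier G. sat G (e(i := a)) p)"

text \<open>
  The variable 0 ranges over the set being defined; the values \<open>e i\<close> of the other free
  variables are the parameters.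
\<close>

definition definable :: "('a, 'f, 'r, 'z) expanded_group_scheme \<Rightarrow> 'a set \<Rightarrow> bool" where
  "definable G A \<longleftrightarrow>
     (\<exists>p e. wf_formula G p \<and> range e \<subseteq> carrier G \<and> A = {x \<in> carrier G. sat G (e(0 := x)) p})"


section \<open>The chain condition\<close>

definition centralizer :: "('a, 'b) monoid_scheme \<Rightarrow> 'a set \<Rightarrow> 'a set" where
  "centralizer G S = {x \<in> carrier G. \<forall>y\<in>S. x \<otimes>\<^bsub>G\<^esub> y = y \<otimes>\<^bsub>G\<^esub> x}"

text \<open>
  The infinite case is separate because \<open>card\<close> is 0 on infinite sets: infinite index counts
  as index at least \<open>d\<close>.
\<close>

definition index_at_least :: "('a, 'b) monoid_scheme \<Rightarrow> 'a set \<Rightarrow> 'a set \<Rightarrow> nat \<Rightarrow> bool" where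
  "index_at_least G A B d \<longleftrightarrow>
     (let cosets = rcosets\<^bsub>G\<lparr>carrier := A\<rparr>\<^esub> B in infinite cosets \<or> d \<le> card cosets)"

text \<open>
  \<open>quotient_centralizer G H N g i\<close> is the centralizer of \<open>g\<^sub>0N, \<dots>, g\<^sub>iN\<close> in
  \<open>H/N = H/(H \<inter> N)\<close>. When \<open>H\<close> normalizes \<open>N\<close>, left and right cosets of \<open>H \<inter> N\<close> in \<open>H\<close>
  coincide.
\<close>

definition quotient_centralizer ::
  "('a, 'b) monoid_scheme \<Rightarrow> 'a set \<Rightarrow> 'a set \<Rightarrow> (nat \<Rightarrow> 'a) \<Rightarrow> nat \<Rightarrow> 'a set set" where
  "quotient_centralizer G H N g i =
     centralizer (G\<lparr>carrier := H\<rparr> Mod (H \<inter> N)) ((\<lambda>j. (H \<inter> N) #>\<^bsub>G\<^esub> g j) ` {..i})"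

text \<open>
  The chain given by \<open>g\<^sub>0, \<dots>, g\<^sub>m\<close> has \<open>m\<close> steps. An infinite chain is excluded by bounding
  its finite initial segments.
\<close>

definition mc_tilde_group :: "('a, 'f, 'r, 'z) expanded_group_scheme \<Rightarrow> bool" where
  "mc_tilde_group G \<longleftrightarrow> expanded_group G \<and>
     (\<forall>H N. subgroup H G \<and> definable G H \<and> subgroup N G \<and> definable G N \<and> H \<subseteq> normalizer G N \<longrightarrow>
       (\<exists>n d. \<forall>m g. g ` {..m} \<subseteq> H \<and>
           (\<forall>i<m. index_at_least (G\<lparr>carrier := H\<rparr> Mod (H \<inter> N))
                    (quotient_centralizer G H N g i) (quotient_centralizer G H N g (Suc i)) d) \<longrightarrow>
         m \<le> n))"


section \<open>Nilpotency and the Fitting subgroup\<close>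

text \<open>The series starts at index 0: \<open>lower_central G n\<close> is \<open>\<gamma>\<^sub>n\<^sub>+\<^sub>1(G)\<close>.\<close>

primrec lower_central :: "('a, 'b) monoid_scheme \<Rightarrow> nat \<Rightarrow> 'a set" where
  "lower_central G 0 = carrier G"
| "lower_central G (Suc n) = generate G
     (\<Union>x\<in>lower_central G n. \<Union>y\<in>carrier G. {x \<otimes>\<^bsub>G\<^esub> y \<otimes>\<^bsub>G\<^esub> inv\<^bsub>G\<^esub> x \<otimes>\<^bsub>G\<^esub> inv\<^bsub>G\<^esub> y})"

definition nilpotent_group :: "('a, 'b) monoid_scheme \<Rightarrow> bool" where
  "nilpotent_group G \<longleftrightarrow> group G \<and> (\<exists>n. lower_central G n = {\<one>\<^bsub>G\<^esub>})"

definition fitting_subgroup :: "('a, 'b) monoid_scheme \<Rightarrow> 'a set" where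
  "fitting_subgroup G = generate G (\<Union>{N. N \<lhd> G \<and> nilpotent_group (G\<lparr>carrier := N\<rparr>)})"

end

(*
  Write [A, F, ..., F] for iterated commutators with the Fitting subgroup F. For a normal
  subgroup M and a definable normal subgroup B, the almost centralizer of M modulo B (the
  elements centralizing a finite-index subgroup of M modulo B) is again definable, because the
  chain condition replaces M by the centralizer of a finite set. By B. H. Neumann's theorems on
  coset coverings and on commutators, and because finitely many elements of F lie in one normal
  nilpotent subgroup, F acts nilpotently on its intersection with its almost centralizer modulo
  B; hence every term Z_r(F) of the upper central series lies in a definable normal subgroup on
  which F still acts nilpotently. Such hulls serve as denominators in an induction showing that
  F acts nilpotently on an abelian normal section A whenever F is nilpotent modulo the
  centralizer of A.

  By the chain condition there is an r such that M = C_F(Z_r(F)) is almost centralized by each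
  element of the union Y of all Z_i(F), so Y lies in the almost centralizer P of M. Here F/M is
  nilpotent, since F stabilizes the series of the
  Z_i(F) below Z_r(F), and so F acts nilpotently on the intersection of M and P. If M were not
  contained in P, some x in M outside P would satisfy [x, F] <= P; then x would lie in Y, hence
  in P, a contradiction. So M is contained in P, and F acts nilpotently on M and on F/M.
*)
theory Submission
  imports Defs
begin

section \<open>Relative centralizers\<close>

text \<open>The normal nilpotent subgroups generating \<open>F\<close> have no common bound on their
  class, and neither \<open>F\<close> nor its central series need be definable, while the chain
  condition speaks only of definable denominators and only up to finite index. Each use of it yields
  a finite set \<open>S0\<close> and a number \<open>d\<close> such that every member of a given
  family centralizes, modulo \<open>B\<close>, a subgroup of index at most \<open>d\<close> in the
  centralizer of \<open>S0\<close>. The uniformity of \<open>d\<close> matters twice: it makes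
  almost centralization a first-order property, and it supplies the common index bounds behind the
  symmetry of almost centralization and the finiteness of commutator sets. What is lost to finite
  index is recovered by one device. Finitely many coset representatives lie in a normal
  \<open>N\<close> with \<open>[G, N, ..., N] = 1\<close>; so if an \<open>F\<close>-invariant
  \<open>K\<close> of finite index in \<open>F\<close> centralizes something modulo
  \<open>B\<close>, then \<open>F\<close> acts on it modulo \<open>B\<close> just as
  \<open>N\<close> does, hence nilpotently.\<close>

context group
begin

definition comm :: "'a \<Rightarrow> 'a \<Rightarrow> 'a" where
  "comm x y = x \<otimes> y \<otimes> inv x \<otimes> inv y"

definition cent :: "'a set \<Rightarrow> 'a set \<Rightarrow> 'a set" where
  "cent N B = {x \<in> carrier G. \<forall>y\<in>N. comm x y \<in> B}"

text \<open>\<open>A \<subseteq> up N n B\<close> expresses \<open>[A, N, \<dots>, N] \<le> B\<close> with \<open>n\<close> factors \<open>N\<close>.\<close>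

abbreviation up :: "'a set \<Rightarrow> nat \<Rightarrow> 'a set \<Rightarrow> 'a set" where
  "up N n \<equiv> cent N ^^ n"

text \<open>
  The subgroup \<open>A \<inter> H\<close> has index at most \<open>n\<close> in \<open>A\<close>, expressed by a colouring of \<open>A\<close>; in this
  form \<open>H\<close> need not be contained in \<open>A\<close>.
\<close>

definition index_le :: "'a set \<Rightarrow> 'a set \<Rightarrow> nat \<Rightarrow> bool" where
  "index_le A H n \<longleftrightarrow>
     (\<exists>\<phi>::'a \<Rightarrow> nat. \<phi> ` A \<subseteq> {..<n} \<and> (\<forall>a\<in>A. \<forall>b\<in>A. \<phi> a = \<phi> b \<longrightarrow> inv a \<otimes> b \<in> H))"

lemma mult_inv_cancel_left [simp]:
  assumes "x \<in> carrier G" "y \<in> carrier G"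
  shows "x \<otimes> (inv x \<otimes> y) = y" "inv x \<otimes> (x \<otimes> y) = y"
  using assms by (simp_all add: m_assoc [symmetric])

lemmas word_simps = m_assoc inv_mult_group

section \<open>Commutator calculus and normal subgroups\<close>

lemma comm_closed [simp, intro]: "x \<in> carrier G \<Longrightarrow> y \<in> carrier G \<Longrightarrow> comm x y \<in> carrier G"
  by (simp add: comm_def)

lemma comm_inverse: "x \<in> carrier G \<Longrightarrow> y \<in> carrier G \<Longrightarrow> inv (comm x y) = comm y x"
  by (simp add: comm_def word_simps)

lemma comm_mult_right:
  assumes "x \<in> carrier G" "y \<in> carrier G" "z \<in> carrier G"
  shows "comm x (y \<otimes> z) = comm x y \<otimes> (y \<otimes> comm x z \<otimes> inv y)"
  using assms by (simp add: comm_def word_simps)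

lemma comm_mult_left:
  assumes "x \<in> carrier G" "y \<in> carrier G" "z \<in> carrier G"
  shows "comm (x \<otimes> y) z = (x \<otimes> comm y z \<otimes> inv x) \<otimes> comm x z"
  using assms by (simp add: comm_def word_simps)

lemma comm_conj:
  assumes "g \<in> carrier G" "x \<in> carrier G" "y \<in> carrier G"
  shows "g \<otimes> comm x y \<otimes> inv g = comm (g \<otimes> x \<otimes> inv g) (g \<otimes> y \<otimes> inv g)"
  using assms by (simp add: comm_def word_simps)

lemma comm_eq_one_iff:
  assumes "x \<in> carrier G" "y \<in> carrier G"
  shows "comm x y = \<one> \<longleftrightarrow> x \<otimes> y = y \<otimes> x"
proof -
  have "comm x y = (x \<otimes> y) \<otimes> inv (y \<otimes> x)"
    using assms by (simp add: comm_def word_simps)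
  then show ?thesis
    using assms by (metis inv_closed inv_equality inv_inv m_closed r_inv)
qed

lemma normal_sub: "N \<lhd> G \<Longrightarrow> x \<in> N \<Longrightarrow> x \<in> carrier G"
  by (meson normal_imp_subgroup subgroup.mem_carrier)

lemma normal_subset: "N \<lhd> G \<Longrightarrow> N \<subseteq> carrier G"
  by (blast intro: normal_sub)

lemma normal_conj: "N \<lhd> G \<Longrightarrow> x \<in> N \<Longrightarrow> g \<in> carrier G \<Longrightarrow> g \<otimes> x \<otimes> inv g \<in> N"
  by (simp add: normal_inv_iff)

lemma normal_conj': "N \<lhd> G \<Longrightarrow> x \<in> N \<Longrightarrow> g \<in> carrier G \<Longrightarrow> inv g \<otimes> x \<otimes> g \<in> N"
  by (simp add: normal.inv_op_closed1)

lemma normal_mult: "N \<lhd> G \<Longrightarrow> x \<in> N \<Longrightarrow> y \<in> N \<Longrightarrow> x \<otimes> y \<in> N"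
  by (meson normal_imp_subgroup subgroup.m_closed)

lemma normal_inv: "N \<lhd> G \<Longrightarrow> x \<in> N \<Longrightarrow> inv x \<in> N"
  by (meson normal_imp_subgroup subgroup.m_inv_closed)

lemma normal_one: "N \<lhd> G \<Longrightarrow> \<one> \<in> N"
  by (meson normal_imp_subgroup subgroup.one_closed)

lemma comm_in_normal_left:
  assumes "N \<lhd> G" "x \<in> N" "g \<in> carrier G"
  shows "comm x g \<in> N"
proof -
  have "x \<otimes> (g \<otimes> inv x \<otimes> inv g) \<in> N"
    using assms by (intro normal_mult normal_conj normal_inv)
  then show ?thesis
    using assms normal_sub by (simp add: comm_def word_simps)
qed

lemma comm_in_normal_right:
  assumes "N \<lhd> G" "x \<in> N" "g \<in> carrier G"
  shows "comm g x \<in> N"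
  using comm_in_normal_left [OF assms] assms comm_inverse normal_inv normal_sub by metis

lemma comm_sym: "B \<lhd> G \<Longrightarrow> x \<in> carrier G \<Longrightarrow> y \<in> carrier G \<Longrightarrow> comm x y \<in> B \<longleftrightarrow> comm y x \<in> B"
  using comm_inverse normal_inv by metis

section \<open>Commutators modulo a normal subgroup\<close>

lemma quotient_hom: "B \<lhd> G \<Longrightarrow> group_hom G (G Mod B) (\<lambda>x. B #> x)"
  by (simp add: group_hom_axioms_def group_hom_def group_axioms normal.factorgroup_is_group
      normal.r_coset_hom_Mod)

lemma quotient_one_iff:
  assumes "B \<lhd> G" "x \<in> carrier G"
  shows "B #> x = \<one>\<^bsub>G Mod B\<^esub> \<longleftrightarrow> x \<in> B"
  using assms coset_join1 coset_join2 normal_imp_subgroup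
  by (metis FactGroup_def monoid.select_convs(2) subgroup.subset)

lemma quotient_eq_iff:
  assumes "B \<lhd> G" "x \<in> carrier G" "y \<in> carrier G"
  shows "B #> x = B #> y \<longleftrightarrow> inv x \<otimes> y \<in> B"
proof -
  interpret q: group_hom G "G Mod B" "\<lambda>x. B #> x" using assms(1) by (rule quotient_hom)
  have "inv x \<otimes> y \<in> B \<longleftrightarrow> inv\<^bsub>G Mod B\<^esub> (B #> x) \<otimes>\<^bsub>G Mod B\<^esub> (B #> y) = \<one>\<^bsub>G Mod B\<^esub>"
    using assms quotient_one_iff [of B "inv x \<otimes> y"] by simp
  also have "\<dots> \<longleftrightarrow> B #> x = B #> y"
    using assms q.H.inv_equality q.H.inv_inv q.H.l_inv
    by (metis q.H.inv_closed q.hom_closed)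
  finally show ?thesis by simp
qed

lemma quotient_comm:
  assumes "B \<lhd> G" "x \<in> carrier G" "y \<in> carrier G"
  shows "B #> comm x y = group.comm (G Mod B) (B #> x) (B #> y)"
proof -
  interpret q: group_hom G "G Mod B" "\<lambda>x. B #> x" using assms(1) by (rule quotient_hom)
  show ?thesis using assms by (simp add: comm_def q.H.comm_def)
qed

lemma comm_in_iff:
  assumes "B \<lhd> G" "x \<in> carrier G" "y \<in> carrier G"
  shows "comm x y \<in> B \<longleftrightarrow>
    (B #> x) \<otimes>\<^bsub>G Mod B\<^esub> (B #> y) = (B #> y) \<otimes>\<^bsub>G Mod B\<^esub> (B #> x)"
proof -
  interpret q: group_hom G "G Mod B" "\<lambda>x. B #> x" using assms(1) by (rule quotient_hom)
  show ?thesis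
    using assms quotient_one_iff [of B "comm x y"] quotient_comm [of B x y]
      q.H.comm_eq_one_iff [of "B #> x" "B #> y"] q.hom_closed comm_closed by metis
qed

section \<open>Relative centralizers and their iterates\<close>

lemma centI: "x \<in> carrier G \<Longrightarrow> (\<And>y. y \<in> N \<Longrightarrow> comm x y \<in> B) \<Longrightarrow> x \<in> cent N B"
  by (simp add: cent_def)

lemma centD: "x \<in> cent N B \<Longrightarrow> y \<in> N \<Longrightarrow> comm x y \<in> B"
  by (simp add: cent_def)

lemma cent_closed: "x \<in> cent N B \<Longrightarrow> x \<in> carrier G"
  by (simp add: cent_def)

lemma cent_subset: "cent N B \<subseteq> carrier G"
  by (auto simp: cent_def)

lemma cent_mono: "B \<subseteq> B' \<Longrightarrow> cent N B \<subseteq> cent N B'"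
  by (auto simp: cent_def)

lemma cent_antimono: "N \<subseteq> N' \<Longrightarrow> cent N' B \<subseteq> cent N B"
  by (auto simp: cent_def)

lemma up_mono: "B \<subseteq> B' \<Longrightarrow> up N n B \<subseteq> up N n B'"
  by (induction n) (auto dest: cent_mono)

lemma up_antimono: "N \<subseteq> N' \<Longrightarrow> up N' n B \<subseteq> up N n B"
proof (induction n)
  case (Suc n)
  then show ?case
    using cent_mono [of "up N' n B" "up N n B" N'] cent_antimono [of N N'] by fastforce
qed simp

lemma up_add: "up N (m + n) B = up N m (up N n B)"
  by (simp add: funpow_add)

lemma cent_subgroup:
  assumes "B \<lhd> G" "N \<subseteq> carrier G"
  shows "subgroup (cent N B) G"
proof (rule subgroupI)
  show "cent N B \<noteq> {}"
    using assms normal_one by (auto simp: cent_def comm_def intro!: exI [of _ \<one>])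
next
  fix a assume "a \<in> cent N B"
  then have a: "a \<in> carrier G" "\<And>y. y \<in> N \<Longrightarrow> comm a y \<in> B" by (auto simp: cent_def)
  have "comm (inv a) y \<in> B" if y: "y \<in> N" for y
  proof -
    have "comm (inv a) y = inv a \<otimes> inv (comm a y) \<otimes> a"
      using a y assms by (simp add: comm_def word_simps subsetD)
    then show ?thesis using a y assms by (simp add: normal_inv normal_conj')
  qed
  then show "inv a \<in> cent N B" using a by (simp add: cent_def)
next
  fix a b assume "a \<in> cent N B" "b \<in> cent N B"
  then have a: "a \<in> carrier G" "\<And>y. y \<in> N \<Longrightarrow> comm a y \<in> B"
    and b: "b \<in> carrier G" "\<And>y. y \<in> N \<Longrightarrow> comm b y \<in> B" by (auto simp: cent_def)
  have "comm (a \<otimes> b) y \<in> B" if y: "y \<in> N" for y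
  proof -
    have "y \<in> carrier G" using y assms by auto
    then show ?thesis
      using a b y assms by (simp add: comm_mult_left normal_mult normal_conj)
  qed
  then show "a \<otimes> b \<in> cent N B" using a b by (simp add: cent_def)
qed (simp add: cent_subset)

lemma cent_conj:
  assumes "B \<lhd> G" "g \<in> carrier G" "x \<in> cent N B" "N \<subseteq> carrier G"
    and "\<And>y. y \<in> N \<Longrightarrow> inv g \<otimes> y \<otimes> g \<in> N"
  shows "g \<otimes> x \<otimes> inv g \<in> cent N B"
proof -
  have x: "x \<in> carrier G" "\<And>y. y \<in> N \<Longrightarrow> comm x y \<in> B" using assms by (auto simp: cent_def)
  have "comm (g \<otimes> x \<otimes> inv g) y \<in> B" if y: "y \<in> N" for y
  proof -
    have yc: "y \<in> carrier G" using y assms by auto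
    have "g \<otimes> comm x (inv g \<otimes> y \<otimes> g) \<otimes> inv g \<in> B"
      using x y assms by (simp add: normal_conj)
    then show ?thesis using comm_conj [of g x "inv g \<otimes> y \<otimes> g"] assms(2) yc x
      by (simp add: word_simps)
  qed
  then show ?thesis using x assms by (simp add: cent_def)
qed

lemma cent_normal:
  assumes "B \<lhd> G" "N \<lhd> G"
  shows "cent N B \<lhd> G"
proof (rule normal_invI)
  show "subgroup (cent N B) G" using assms by (intro cent_subgroup normal_subset)
  fix x h assume "x \<in> carrier G" "h \<in> cent N B"
  then show "x \<otimes> h \<otimes> inv x \<in> cent N B"
    using assms by (intro cent_conj normal_subset) (auto intro: normal_conj')
qed

lemma up_normal: "B \<lhd> G \<Longrightarrow> N \<lhd> G \<Longrightarrow> up N n B \<lhd> G"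
  by (induction n) (auto intro: cent_normal)

lemma cent_increasing: "B \<lhd> G \<Longrightarrow> N \<subseteq> carrier G \<Longrightarrow> B \<subseteq> cent N B"
  by (auto simp: cent_def normal_sub intro: comm_in_normal_left)

lemma up_le:
  assumes "B \<lhd> G" "N \<lhd> G" "m \<le> n"
  shows "up N m B \<subseteq> up N n B"
  using assms(3)
proof (induction n rule: dec_induct)
  case (step n)
  then show ?case
    using cent_increasing [OF up_normal [OF assms(1,2)] normal_subset [OF assms(2)]] by fastforce
qed simp

lemma up_increasing: "B \<lhd> G \<Longrightarrow> N \<lhd> G \<Longrightarrow> B \<subseteq> up N n B"
  using up_le [of B N 0 n] by simp

text \<open>Commutators formed from elements of the normal subgroup \<open>F\<close> stay in
  \<open>F\<close>. This allows a nilpotent action modulo some \<open>B'\<close> to be composed with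
  one that is known only on \<open>F \<inter> B'\<close>.\<close>

lemma up_Int:
  assumes "F \<lhd> G" "N \<subseteq> carrier G"
  shows "F \<inter> up N n B \<subseteq> up N n (F \<inter> B)"
proof (induction n)
  case (Suc n)
  show ?case
  proof
    fix x assume x: "x \<in> F \<inter> up N (Suc n) B"
    then have "comm x y \<in> F \<inter> up N n B" if "y \<in> N" for y
      using that assms comm_in_normal_left [of F x y] centD [of x N "up N n B" y] by auto
    then show "x \<in> up N (Suc n) (F \<inter> B)"
      using Suc x assms(1) normal_sub by (auto intro!: centI)
  qed
qed simp

text \<open>At the first stage where \<open>M\<close> meets the iterated centralizer outside
  \<open>P\<close>, commutators with \<open>N\<close> fall into \<open>M\<close> and into the
  previous stage, hence into \<open>P\<close>.\<close>

lemma exists_central_step: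
  assumes "M \<lhd> G" "N \<subseteq> carrier G" "\<not> M \<inter> up N n P \<subseteq> P"
  shows "\<exists>x\<in>M - P. x \<in> cent N P"
  using assms(3)
proof (induction n)
  case (Suc n)
  show ?case
  proof (cases "M \<inter> up N n P \<subseteq> P")
    case True
    obtain x where x: "x \<in> M" "x \<in> up N (Suc n) P" "x \<notin> P" using Suc.prems by blast
    have "comm x y \<in> P" if "y \<in> N" for y
      using that x assms comm_in_normal_left [of M x y] True centD [of x N "up N n P" y] by auto
    then show ?thesis using x assms(1) normal_sub by (auto intro!: centI)
  qed (use Suc.IH in blast)
qed simp

subsection \<open>Subgroups of bounded index\<close>

lemma index_leI:
  assumes "finite (\<psi> ` A)" "card (\<psi> ` A) \<le> n"
    and "\<And>a b. a \<in> A \<Longrightarrow> b \<in> A \<Longrightarrow> \<psi> a = \<psi> b \<Longrightarrow> inv a \<otimes> b \<in> H"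
  shows "index_le A H n"
proof -
  obtain h where h: "bij_betw h (\<psi> ` A) {0..<card (\<psi> ` A)}"
    using ex_bij_betw_finite_nat [OF assms(1)] by blast
  have "(h \<circ> \<psi>) ` A \<subseteq> {..<n}"
    using bij_betwE [OF h] assms(2) by fastforce
  moreover have "inv a \<otimes> b \<in> H" if "a \<in> A" "b \<in> A" "(h \<circ> \<psi>) a = (h \<circ> \<psi>) b" for a b
    using that assms(3) bij_betw_imp_inj_on [OF h] by (simp add: inj_on_eq_iff)
  ultimately show ?thesis unfolding index_le_def by blast
qed

lemma index_leE:
  assumes "index_le A H n"
  obtains \<phi> :: "'a \<Rightarrow> nat" where "\<phi> ` A \<subseteq> {..<n}"
    "\<And>a b. a \<in> A \<Longrightarrow> b \<in> A \<Longrightarrow> \<phi> a = \<phi> b \<Longrightarrow> inv a \<otimes> b \<in> H"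
  using assms unfolding index_le_def by blast

lemma index_le_mono: "index_le A H n \<Longrightarrow> A' \<subseteq> A \<Longrightarrow> H \<subseteq> H' \<Longrightarrow> index_le A' H' n"
  unfolding index_le_def by (meson image_mono subset_iff subset_trans)

lemma index_le_image:
  assumes "index_le A H n"
    and "\<And>a b. a \<in> A \<Longrightarrow> b \<in> A \<Longrightarrow> inv a \<otimes> b \<in> H \<Longrightarrow> g a = g b"
  shows "finite (g ` A)" "card (g ` A) \<le> n"
proof -
  obtain \<phi> :: "'a \<Rightarrow> nat" where \<phi>: "\<phi> ` A \<subseteq> {..<n}"
    "\<And>a b. a \<in> A \<Longrightarrow> b \<in> A \<Longrightarrow> \<phi> a = \<phi> b \<Longrightarrow> inv a \<otimes> b \<in> H"
    using assms(1) unfolding index_le_def by blast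
  have "g a = g (inv_into A \<phi> (\<phi> a))" if "a \<in> A" for a
    by (rule assms(2)) (use that \<phi>(2) in \<open>auto simp: inv_into_into f_inv_into_f\<close>)
  then have g: "g ` A = (g \<circ> inv_into A \<phi>) ` \<phi> ` A" by (force simp: image_iff)
  have fin: "finite (\<phi> ` A)" using \<phi>(1) finite_subset by blast
  then show "finite (g ` A)" unfolding g by (rule finite_imageI)
  have "card (g ` A) \<le> card (\<phi> ` A)" unfolding g by (rule card_image_le [OF fin])
  also have "\<dots> \<le> n" using card_mono [OF _ \<phi>(1)] by simp
  finally show "card (g ` A) \<le> n" .
qed

lemma index_le_cover:
  assumes "index_le A H n"
  obtains R where "finite R" "R \<subseteq> A" "\<And>a. a \<in> A \<Longrightarrow> \<exists>r\<in>R. inv r \<otimes> a \<in> H"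
proof -
  obtain \<phi> :: "'a \<Rightarrow> nat" where \<phi>: "\<phi> ` A \<subseteq> {..<n}"
    "\<And>a b. a \<in> A \<Longrightarrow> b \<in> A \<Longrightarrow> \<phi> a = \<phi> b \<Longrightarrow> inv a \<otimes> b \<in> H"
    using assms(1) unfolding index_le_def by blast
  have "finite (\<phi> ` A)" using \<phi>(1) finite_subset by blast
  then obtain R where R: "R \<subseteq> A" "finite R" "\<phi> ` A = \<phi> ` R"
    using finite_subset_image [of "\<phi> ` A" \<phi> A] by auto
  show thesis
  proof (rule that [OF R(2,1)])
    fix a assume "a \<in> A"
    then obtain r where "r \<in> R" "\<phi> r = \<phi> a" using R(3) by (metis imageE imageI)
    then show "\<exists>r\<in>R. inv r \<otimes> a \<in> H" using R(1) \<phi>(2) \<open>a \<in> A\<close> by blast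
  qed
qed

lemma index_le_Int:
  assumes "index_le A H m" "index_le A K n"
  shows "index_le A (H \<inter> K) (m * n)"
proof -
  obtain \<phi> :: "'a \<Rightarrow> nat" where \<phi>: "\<phi> ` A \<subseteq> {..<m}"
    "\<And>a b. a \<in> A \<Longrightarrow> b \<in> A \<Longrightarrow> \<phi> a = \<phi> b \<Longrightarrow> inv a \<otimes> b \<in> H"
    using assms(1) unfolding index_le_def by blast
  obtain \<psi> :: "'a \<Rightarrow> nat" where \<psi>: "\<psi> ` A \<subseteq> {..<n}"
    "\<And>a b. a \<in> A \<Longrightarrow> b \<in> A \<Longrightarrow> \<psi> a = \<psi> b \<Longrightarrow> inv a \<otimes> b \<in> K"
    using assms(2) unfolding index_le_def by blast
  have sub: "(\<lambda>a. (\<phi> a, \<psi> a)) ` A \<subseteq> {..<m} \<times> {..<n}" using \<phi>(1) \<psi>(1) by auto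
  show ?thesis
  proof (rule index_leI [where \<psi> = "\<lambda>a. (\<phi> a, \<psi> a)"])
    show "finite ((\<lambda>a. (\<phi> a, \<psi> a)) ` A)" using finite_subset [OF sub] by blast
    show "card ((\<lambda>a. (\<phi> a, \<psi> a)) ` A) \<le> m * n"
      using card_mono [OF _ sub] by (simp add: card_cartesian_product)
  qed (use \<phi>(2) \<psi>(2) in auto)
qed

lemma index_le_finite_Int:
  assumes "finite S" "\<And>s. s \<in> S \<Longrightarrow> \<exists>n. index_le A (H s) n"
  shows "\<exists>n. index_le A (\<Inter>s\<in>S. H s) n"
  using assms
proof (induction S)
  case empty
  have "index_le A UNIV 1" unfolding index_le_def by (intro exI [of _ "\<lambda>_. 0"]) auto
  then show ?case by auto
next
  case (insert s S)
  then obtain m n where "index_le A (H s) m" "index_le A (\<Inter>s\<in>S. H s) n" by blast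
  then have "index_le A (H s \<inter> (\<Inter>s\<in>S. H s)) (m * n)" by (rule index_le_Int)
  then show ?case by (auto simp: INT_insert)
qed

lemma index_le_trans:
  assumes "index_le A D m" "index_le D H n" "A \<subseteq> carrier G"
  shows "index_le A H (m * n)"
proof -
  obtain \<phi> :: "'a \<Rightarrow> nat" where \<phi>: "\<phi> ` A \<subseteq> {..<m}"
    "\<And>a b. a \<in> A \<Longrightarrow> b \<in> A \<Longrightarrow> \<phi> a = \<phi> b \<Longrightarrow> inv a \<otimes> b \<in> D"
    using assms(1) unfolding index_le_def by blast
  obtain \<psi> :: "'a \<Rightarrow> nat" where \<psi>: "\<psi> ` D \<subseteq> {..<n}"
    "\<And>a b. a \<in> D \<Longrightarrow> b \<in> D \<Longrightarrow> \<psi> a = \<psi> b \<Longrightarrow> inv a \<otimes> b \<in> H"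
    using assms(2) unfolding index_le_def by blast
  \<comment> \<open>\<open>r a\<close> represents the colour class of \<open>a\<close>. The element
    \<open>inv (r a) \<otimes> a\<close> lies in \<open>D\<close> and is there coloured by
    \<open>\<psi>\<close>.\<close>
  define r where "r a = inv_into A \<phi> (\<phi> a)" for a
  have r: "r a \<in> A" "inv (r a) \<otimes> a \<in> D" if "a \<in> A" for a
    using that \<phi>(2) [of "r a" a] by (auto simp: r_def inv_into_into f_inv_into_f)
  let ?f = "\<lambda>a. (\<phi> a, \<psi> (inv (r a) \<otimes> a))"
  have sub: "?f ` A \<subseteq> {..<m} \<times> {..<n}"
    using \<phi>(1) \<psi>(1) r by (auto simp: image_subset_iff)
  show ?thesis
  proof (rule index_leI [where \<psi> = ?f])
    show "finite (?f ` A)" using finite_subset [OF sub] by blast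
    show "card (?f ` A) \<le> m * n"
      using card_mono [OF _ sub] by (simp add: card_cartesian_product)
    fix a b assume ab: "a \<in> A" "b \<in> A" "?f a = ?f b"
    then have "r a = r b" by (simp add: r_def)
    then have "inv (inv (r a) \<otimes> a) \<otimes> (inv (r a) \<otimes> b) \<in> H"
      using ab \<psi>(2) r by (metis prod.inject)
    moreover have "a \<in> carrier G" "b \<in> carrier G" "r a \<in> carrier G"
      using ab r assms(3) by auto
    ultimately show "inv a \<otimes> b \<in> H" by (simp add: word_simps)
  qed
qed

text \<open>The pigeonhole direction of the tuple form of \<open>index_le\<close>; note that
  \<open>{..n}\<close> indexes \<open>n + 1\<close> elements.\<close>

lemma index_le_tupleD:
  assumes "index_le A H n" "r ` {..n} \<subseteq> A"
  shows "\<exists>i\<le>n. \<exists>j\<le>n. i \<noteq> j \<and> inv (r i) \<otimes> r j \<in> H"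
proof -
  obtain \<phi> :: "'a \<Rightarrow> nat" where \<phi>: "\<phi> ` A \<subseteq> {..<n}"
    "\<And>a b. a \<in> A \<Longrightarrow> b \<in> A \<Longrightarrow> \<phi> a = \<phi> b \<Longrightarrow> inv a \<otimes> b \<in> H"
    using assms(1) unfolding index_le_def by blast
  have "card ((\<phi> \<circ> r) ` {..n}) \<le> card {..<n}" using \<phi>(1) assms(2) by (intro card_mono) auto
  then have "\<not> inj_on (\<phi> \<circ> r) {..n}" using pigeonhole [of "\<phi> \<circ> r" "{..n}"] by simp
  then obtain i j where "i \<le> n" "j \<le> n" "i \<noteq> j" "\<phi> (r i) = \<phi> (r j)"
    by (auto simp: inj_on_def)
  then show ?thesis using \<phi>(2) [of "r i" "r j"] assms(2) by (auto simp: image_subset_iff)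
qed

text \<open>With the pigeonhole direction this turns a bound on the index into the absence of
  \<open>n + 1\<close> elements in distinct cosets. In that form the bound is first-order, and it
  can be played against coset coverings.\<close>

lemma index_le_tupleI:
  assumes "subgroup H G" "A \<subseteq> carrier G" "\<not> index_le A H n"
  obtains r :: "nat \<Rightarrow> 'a" where "r ` {..n} \<subseteq> A"
    "\<And>i j. i \<le> n \<Longrightarrow> j \<le> n \<Longrightarrow> i \<noteq> j \<Longrightarrow> inv (r i) \<otimes> r j \<notin> H"
proof -
  interpret H: subgroup H G by (rule assms(1))
  define \<psi> where "\<psi> a = {b \<in> A. inv a \<otimes> b \<in> H}" for a
  have eq: "\<psi> a = \<psi> b \<longleftrightarrow> inv a \<otimes> b \<in> H" if "a \<in> A" "b \<in> A" for a b
  proof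
    assume "\<psi> a = \<psi> b"
    moreover have "b \<in> \<psi> b" using that assms(2) by (auto simp: \<psi>_def subset_iff)
    ultimately show "inv a \<otimes> b \<in> H" by (auto simp: \<psi>_def)
  next
    assume ab: "inv a \<otimes> b \<in> H"
    have c: "a \<in> carrier G" "b \<in> carrier G" using that assms(2) by auto
    have "inv a \<otimes> x \<in> H \<longleftrightarrow> inv b \<otimes> x \<in> H" if x: "x \<in> carrier G" for x
    proof
      assume "inv a \<otimes> x \<in> H"
      then have "inv (inv a \<otimes> b) \<otimes> (inv a \<otimes> x) \<in> H" using ab by blast
      then show "inv b \<otimes> x \<in> H" using c x by (simp add: word_simps)
    next
      assume "inv b \<otimes> x \<in> H"
      then have "(inv a \<otimes> b) \<otimes> (inv b \<otimes> x) \<in> H" using ab by blast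
      then show "inv a \<otimes> x \<in> H" using c x by (simp add: word_simps)
    qed
    then show "\<psi> a = \<psi> b" using assms(2) by (auto simp: \<psi>_def)
  qed
  have "\<not> (finite (\<psi> ` A) \<and> card (\<psi> ` A) \<le> n)"
    using index_leI [of \<psi> A n H] eq assms(3) by blast
  then obtain T where T: "T \<subseteq> \<psi> ` A" "card T = Suc n" "finite T"
    by (metis card.infinite infinite_arbitrarily_large not_less_eq_eq obtain_subset_with_card_n)
  then obtain h where h: "bij_betw h {0..<Suc n} T" using ex_bij_betw_nat_finite by metis
  define r where "r i = inv_into A \<psi> (h i)" for i
  have r: "r i \<in> A" "\<psi> (r i) = h i" if "i \<le> n" for i
  proof -
    have "h i \<in> \<psi> ` A" using T(1) bij_betwE [OF h] that by auto
    then show "r i \<in> A" "\<psi> (r i) = h i" by (simp_all add: r_def inv_into_into f_inv_into_f)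
  qed
  show thesis
  proof (rule that)
    show "r ` {..n} \<subseteq> A" using r by auto
    fix i j assume "i \<le> n" "j \<le> n" "i \<noteq> j"
    then show "inv (r i) \<otimes> r j \<notin> H"
      using eq [of "r i" "r j"] r inj_on_eq_iff [OF bij_betw_imp_inj_on [OF h], of i j] by auto
  qed
qed

section \<open>Neumann's theorems on commutators and on coset coverings\<close>

text \<open>
  The idea is to fix \<open>x0\<close> with an \<open>N\<close>-orbit of maximal size. If \<open>y\<close> commutes with
  representatives for this orbit, the orbit of \<open>x0 y\<close> is that of \<open>x0\<close> times \<open>y\<close>, which leaves
  only finitely many values for \<open>[n, y]\<close>.
\<close>

lemma finite_commutators_centralizers:
  assumes U: "subgroup U G" and N: "subgroup N G"
    and bdd: "\<And>x. x \<in> U \<Longrightarrow> index_le N (cent {x} {\<one>}) e"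
    and fin: "\<And>n. n \<in> N \<Longrightarrow> \<exists>k. index_le U (cent {n} {\<one>}) k"
  shows "finite ((\<lambda>(n, x). comm n x) ` (N \<times> U))"
proof -
  interpret U: subgroup U G by (rule U)
  interpret N: subgroup N G by (rule N)
  define orb where "orb x = (\<lambda>n. n \<otimes> x \<otimes> inv n) ` N" for x
  have conj_eq: "a \<otimes> x \<otimes> inv a = b \<otimes> x \<otimes> inv b"
    if "a \<in> N" "b \<in> N" "x \<in> U" "inv a \<otimes> b \<in> cent {x} {\<one>}" for a b x
  proof -
    have "(inv a \<otimes> b) \<otimes> x = x \<otimes> (inv a \<otimes> b)"
      using that comm_eq_one_iff [of "inv a \<otimes> b" x] by (simp add: cent_def)
    then have "a \<otimes> ((inv a \<otimes> b) \<otimes> x) \<otimes> inv b = a \<otimes> (x \<otimes> (inv a \<otimes> b)) \<otimes> inv b" by simp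
    then show ?thesis using that by (simp add: word_simps)
  qed
  have finO: "finite (orb x)" and cardO: "card (orb x) \<le> e" if "x \<in> U" for x
    unfolding orb_def
    using index_le_image [OF bdd [OF that], of "\<lambda>n. n \<otimes> x \<otimes> inv n"] conj_eq that by blast+
  \<comment> \<open>The common bound \<open>e\<close> on orbit sizes is what makes a largest orbit
    exist.\<close>
  obtain x0 where x0: "x0 \<in> U" and max: "\<And>x. x \<in> U \<Longrightarrow> card (orb x) \<le> card (orb x0)"
    using ex_has_greatest_nat [of "\<lambda>x. x \<in> U" \<one> "\<lambda>x. card (orb x)" "Suc e"]
      cardO U.one_closed less_Suc_eq_le by metis
  have "orb x0 \<subseteq> (\<lambda>n. n \<otimes> x0 \<otimes> inv n) ` N" by (simp add: orb_def)
  from finite_subset_image [OF finO [OF x0] this]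
  obtain R where R: "finite R" "R \<subseteq> N" "orb x0 = (\<lambda>n. n \<otimes> x0 \<otimes> inv n) ` R" by blast
  \<comment> \<open>\<open>D\<close> depends only on \<open>x0\<close>, so it serves all
    \<open>n\<close> and all \<open>y\<close> centralizing \<open>R\<close> at once.\<close>
  define D where "D = (\<lambda>(z', z). inv z' \<otimes> z) ` (orb x0 \<times> orb x0)"
  have finD: "finite D" using finO [OF x0] by (simp add: D_def)
  have orb_closed: "z \<in> carrier G" if "z \<in> orb x" "x \<in> U" for z x using that by (auto simp: orb_def)
  have in_D: "comm n y \<in> D" if n: "n \<in> N" and y: "y \<in> U" "y \<in> cent R {\<one>}" for n y
  proof -
    have sub: "(\<lambda>z. z \<otimes> y) ` orb x0 \<subseteq> orb (x0 \<otimes> y)"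
    proof
      fix u assume "u \<in> (\<lambda>z. z \<otimes> y) ` orb x0"
      then obtain r where r: "r \<in> R" "u = r \<otimes> x0 \<otimes> inv r \<otimes> y" using R(3) by auto
      have c: "r \<in> carrier G" "r \<in> N" using r R(2) by auto
      have "y \<otimes> r = r \<otimes> y"
        using y r c comm_eq_one_iff [of y r] by (simp add: cent_def)
      then have "inv r \<otimes> (y \<otimes> r) \<otimes> inv r = inv r \<otimes> (r \<otimes> y) \<otimes> inv r" by simp
      then have "inv r \<otimes> y = y \<otimes> inv r" using y c by (simp add: word_simps)
      then have "u = r \<otimes> (x0 \<otimes> y) \<otimes> inv r" using r y c x0 by (simp add: word_simps)
      then show "u \<in> orb (x0 \<otimes> y)" using c by (auto simp: orb_def)
    qed
    have "card ((\<lambda>z. z \<otimes> y) ` orb x0) = card (orb x0)"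
      using y x0 by (intro card_image inj_onI) (metis orb_closed r_cancel U.mem_carrier)
    then have "(\<lambda>z. z \<otimes> y) ` orb x0 = orb (x0 \<otimes> y)"
      using max [of "x0 \<otimes> y"] finO [of "x0 \<otimes> y"] sub x0 y
      by (metis U.m_closed card_seteq)
    then obtain z where z: "z \<in> orb x0" "z \<otimes> y = n \<otimes> (x0 \<otimes> y) \<otimes> inv n"
      using n unfolding orb_def by (smt (verit, best) imageE imageI)
    have z': "n \<otimes> x0 \<otimes> inv n \<in> orb x0" using n by (auto simp: orb_def)
    have "comm n y = inv (n \<otimes> x0 \<otimes> inv n) \<otimes> (n \<otimes> (x0 \<otimes> y) \<otimes> inv n) \<otimes> inv y"
      using n y x0 by (simp add: comm_def word_simps)
    also have "\<dots> = inv (n \<otimes> x0 \<otimes> inv n) \<otimes> z"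
      using z(2) [symmetric] n y x0 orb_closed [OF z(1) x0] by (simp add: word_simps)
    finally show ?thesis using z(1) z' by (auto simp: D_def)
  qed
  have "\<exists>k. index_le U (\<Inter>r\<in>R. cent {r} {\<one>}) k"
    using R fin by (intro index_le_finite_Int) auto
  then obtain Q where Q: "finite Q" "Q \<subseteq> U"
    "\<And>x. x \<in> U \<Longrightarrow> \<exists>q\<in>Q. inv q \<otimes> x \<in> (\<Inter>r\<in>R. cent {r} {\<one>})"
    using index_le_cover by metis
  \<comment> \<open>Write \<open>x = q y\<close> with \<open>q\<close> in the finite set
    \<open>Q\<close> and \<open>y\<close> centralizing \<open>R\<close>. Then \<open>[n, x]\<close>
    is \<open>[n, q]\<close> times the conjugate of \<open>[n, y]\<close> by \<open>q\<close>; the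
    orbit of \<open>q\<close> and the set \<open>D\<close> are both finite.\<close>
  have "comm n x \<in> (\<Union>q\<in>Q. (\<lambda>(z, d). z \<otimes> inv q \<otimes> (q \<otimes> d \<otimes> inv q)) ` (orb q \<times> D))"
    if nx: "n \<in> N" "x \<in> U" for n x
  proof -
    obtain q where q: "q \<in> Q" "inv q \<otimes> x \<in> (\<Inter>r\<in>R. cent {r} {\<one>})" using Q nx by blast
    have qX: "q \<in> U" using q Q by auto
    then have "inv q \<otimes> x \<in> cent R {\<one>}" using q nx by (auto simp: cent_def)
    then have d: "comm n (inv q \<otimes> x) \<in> D" using in_D nx qX by blast
    have "comm n x = comm n (q \<otimes> (inv q \<otimes> x))" using nx qX by simp
    also have "\<dots> = (n \<otimes> q \<otimes> inv n) \<otimes> inv q \<otimes> (q \<otimes> comm n (inv q \<otimes> x) \<otimes> inv q)"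
      using nx qX by (simp add: comm_def word_simps)
    finally show ?thesis using q(1) d nx by (force simp: orb_def)
  qed
  then have "(\<lambda>(n, x). comm n x) ` (N \<times> U) \<subseteq>
    (\<Union>q\<in>Q. (\<lambda>(z, d). z \<otimes> inv q \<otimes> (q \<otimes> d \<otimes> inv q)) ` (orb q \<times> D))" by auto
  moreover have "finite (\<Union>q\<in>Q. (\<lambda>(z, d). z \<otimes> inv q \<otimes> (q \<otimes> d \<otimes> inv q)) ` (orb q \<times> D))"
    using Q finO finD by auto
  ultimately show ?thesis by (rule finite_subset)
qed

lemma index_le_quotient:
  assumes "B \<lhd> G" "A \<subseteq> carrier G" "x \<in> carrier G" "index_le A (cent {x} B) n"
  shows "group.index_le (G Mod B) ((\<lambda>a. B #> a) ` A)
    (group.cent (G Mod B) {B #> x} {\<one>\<^bsub>G Mod B\<^esub>}) n"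
proof -
  interpret q: group_hom G "G Mod B" "\<lambda>x. B #> x" using assms(1) by (rule quotient_hom)
  have "\<exists>\<phi>. \<phi> ` A \<subseteq> {..<n} \<and> (\<forall>a\<in>A. \<forall>b\<in>A. \<phi> a = \<phi> b \<longrightarrow> inv a \<otimes> b \<in> cent {x} B)"
    using assms(4) by (simp add: index_le_def)
  then obtain \<phi> :: "'a \<Rightarrow> nat" where \<phi>: "\<phi> ` A \<subseteq> {..<n}"
    "\<And>a b. a \<in> A \<Longrightarrow> b \<in> A \<Longrightarrow> \<phi> a = \<phi> b \<Longrightarrow> inv a \<otimes> b \<in> cent {x} B" by blast
  define s where "s = inv_into A (\<lambda>a. B #> a)"
  have s: "s U \<in> A" "B #> s U = U" if "U \<in> (\<lambda>a. B #> a) ` A" for U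
    using that by (simp_all add: s_def inv_into_into f_inv_into_f [of U "\<lambda>a. B #> a"])
  show ?thesis unfolding q.H.index_le_def
  proof (intro exI [of _ "\<phi> \<circ> s"] conjI ballI impI)
    show "(\<phi> \<circ> s) ` (\<lambda>a. B #> a) ` A \<subseteq> {..<n}" using \<phi>(1) s(1) by auto
    fix U Y assume XY: "U \<in> (\<lambda>a. B #> a) ` A" "Y \<in> (\<lambda>a. B #> a) ` A" "(\<phi> \<circ> s) U = (\<phi> \<circ> s) Y"
    then have "inv (s U) \<otimes> s Y \<in> cent {x} B" using \<phi>(2) s by simp
    then have "comm (inv (s U) \<otimes> s Y) x \<in> B" by (simp add: cent_def)
    moreover have c: "s U \<in> carrier G" "s Y \<in> carrier G" using s XY assms(2) by blast+
    ultimately have "q.H.comm (B #> (inv (s U) \<otimes> s Y)) (B #> x) = \<one>\<^bsub>G Mod B\<^esub>"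
      using quotient_comm [of B] quotient_one_iff [of B] assms by (metis comm_closed inv_closed m_closed)
    moreover have "B #> (inv (s U) \<otimes> s Y) = inv\<^bsub>G Mod B\<^esub> U \<otimes>\<^bsub>G Mod B\<^esub> Y"
      using c s XY by (metis inv_closed q.hom_inv q.hom_mult)
    ultimately show "inv\<^bsub>G Mod B\<^esub> U \<otimes>\<^bsub>G Mod B\<^esub> Y \<in> q.H.cent {B #> x} {\<one>\<^bsub>G Mod B\<^esub>}"
      using c assms q.hom_closed [of "inv (s U) \<otimes> s Y"] by (simp add: q.H.cent_def)
  qed
qed

lemma finite_commutators:
  assumes "B \<lhd> G" and U: "subgroup U G" and N: "subgroup N G"
    and bdd: "\<And>x. x \<in> U \<Longrightarrow> index_le N (cent {x} B) e"
    and fin: "\<And>n. n \<in> N \<Longrightarrow> \<exists>k. index_le U (cent {n} B) k"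
  shows "finite ((\<lambda>(n, x). B #> comm n x) ` (N \<times> U))"
proof -
  interpret q: group_hom G "G Mod B" "\<lambda>x. B #> x" using assms(1) by (rule quotient_hom)
  let ?q = "\<lambda>x. B #> x"
  have c: "U \<subseteq> carrier G" "N \<subseteq> carrier G" using U N by (auto dest: subgroup.subset)
  have "finite ((\<lambda>(n, x). q.H.comm n x) ` (?q ` N \<times> ?q ` U))"
  proof (rule q.H.finite_commutators_centralizers)
    show "subgroup (?q ` U) (G Mod B)" "subgroup (?q ` N) (G Mod B)"
      using U N q.subgroup_img_is_subgroup by blast+
    show "q.H.index_le (?q ` N) (q.H.cent {x} {\<one>\<^bsub>G Mod B\<^esub>}) e" if "x \<in> ?q ` U" for x
      using that index_le_quotient [OF assms(1) c(2) _ bdd] c by auto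
    show "\<exists>k. q.H.index_le (?q ` U) (q.H.cent {n} {\<one>\<^bsub>G Mod B\<^esub>}) k" if "n \<in> ?q ` N" for n
      using that index_le_quotient [OF assms(1) c(1)] fin c by blast
  qed
  moreover have "(\<lambda>(n, x). B #> comm n x) ` (N \<times> U) \<subseteq> (\<lambda>(n, x). q.H.comm n x) ` (?q ` N \<times> ?q ` U)"
  proof clarify
    fix n x assume "n \<in> N" "x \<in> U"
    moreover from this have "B #> comm n x = q.H.comm (?q n) (?q x)"
      using c by (intro quotient_comm [OF assms(1)]) auto
    ultimately show "B #> comm n x \<in> (\<lambda>(n, x). q.H.comm n x) ` (?q ` N \<times> ?q ` U)" by auto
  qed
  ultimately show ?thesis by (rule rev_finite_subset)
qed

lemma coset_covering:
  assumes "finite \<H>" "\<And>H. H \<in> \<H> \<Longrightarrow> subgroup H G" "subgroup F G" "finite T" "T \<subseteq> F"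
    and "\<And>x. x \<in> F \<Longrightarrow> \<exists>H\<in>\<H>. \<exists>t\<in>T. inv t \<otimes> x \<in> H"
  shows "\<exists>H\<in>\<H>. \<exists>n. index_le F H n"
  using assms(1,2,4-)
proof (induction \<H> arbitrary: T)
  case empty
  then show ?case using subgroup.one_closed [OF assms(3)] by blast
next
  case (insert H \<H>)
  interpret F: subgroup F G by (rule assms(3))
  interpret H: subgroup H G using insert.prems by blast
  show ?case
  proof (cases "\<forall>x\<in>F. \<exists>t\<in>T. inv t \<otimes> x \<in> H")
    case True
    define s where "s x = (SOME t. t \<in> T \<and> inv t \<otimes> x \<in> H)" for x
    have s: "s x \<in> T" "inv (s x) \<otimes> x \<in> H" if "x \<in> F" for x
      using someI_ex [of "\<lambda>t. t \<in> T \<and> inv t \<otimes> x \<in> H"] that True unfolding s_def by blast+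
    have "index_le F H (card (s ` F))"
    proof (rule index_leI [where \<psi> = s])
      show "finite (s ` F)" using s(1) insert.prems(2) by (meson finite_subset image_subsetI)
      fix a b assume ab: "a \<in> F" "b \<in> F" "s a = s b"
      then have c: "s a \<in> carrier G" using s(1) [OF ab(1)] insert.prems(3) by auto
      have "inv (inv (s a) \<otimes> a) \<otimes> (inv (s a) \<otimes> b) \<in> H" using ab s by (metis H.m_closed H.m_inv_closed)
      then show "inv a \<otimes> b \<in> H" using ab c by (simp add: word_simps)
    qed simp
    then show ?thesis by blast
  next
    case False
    then obtain g where g: "g \<in> F" "\<And>t. t \<in> T \<Longrightarrow> inv t \<otimes> g \<notin> H" by blast
    \<comment> \<open>Left multiplication by \<open>t \<otimes> inv g\<close> carries
      \<open>g H\<close> onto \<open>t H\<close>, and so each covering coset \<open>t' K\<close> of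
      \<open>g H\<close> onto one with representative
      \<open>t \<otimes> inv g \<otimes> t'\<close>.\<close>
    define T' where "T' = T \<union> (\<lambda>(t, t'). t \<otimes> inv g \<otimes> t') ` (T \<times> T)"
    have "\<exists>H'\<in>\<H>. \<exists>n. index_le F H' n"
    proof (rule insert.IH)
      show "\<And>H. H \<in> \<H> \<Longrightarrow> subgroup H G" using insert.prems by blast
      show "finite T'" "T' \<subseteq> F" using insert.prems g by (auto simp: T'_def)
      fix x assume x: "x \<in> F"
      then obtain H' t where H': "H' \<in> insert H \<H>" "t \<in> T" "inv t \<otimes> x \<in> H'"
        using insert.prems(4) by blast
      show "\<exists>H'\<in>\<H>. \<exists>t\<in>T'. inv t \<otimes> x \<in> H'"
      proof (cases "H' \<in> \<H>")
        case True
        then show ?thesis using H' by (auto simp: T'_def)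
      next
        case False
        then have tx: "inv t \<otimes> x \<in> H" using H' by simp
        have tF: "t \<in> F" using H' insert.prems by auto
        let ?y = "g \<otimes> (inv t \<otimes> x)"
        have "?y \<in> F" using tF x g by simp
        then obtain K t' where K: "K \<in> insert H \<H>" "t' \<in> T" "inv t' \<otimes> ?y \<in> K"
          using insert.prems(4) by blast
        have t'F: "t' \<in> F" using K insert.prems by auto
        have "K \<noteq> H"
        proof
          assume "K = H"
          then have "(inv t' \<otimes> ?y) \<otimes> inv (inv t \<otimes> x) \<in> H" using K(3) tx by blast
          then have "inv t' \<otimes> g \<in> H" using tF t'F x g by (simp add: word_simps)
          then show False using g K by blast
        qed
        then have "K \<in> \<H>" using K by blast
        moreover have "t \<otimes> inv g \<otimes> t' \<in> T'" using K H' by (force simp: T'_def)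
        moreover have "inv (t \<otimes> inv g \<otimes> t') \<otimes> x = inv t' \<otimes> ?y"
          using tF t'F x g by (simp add: word_simps)
        ultimately show ?thesis using K by metis
      qed
    qed
    then show ?thesis by blast
  qed
qed

text \<open>Given \<open>d + 1\<close> elements of \<open>A\<close> in distinct cosets of
  \<open>A1\<close>, every \<open>f\<close> centralizes modulo \<open>B\<close> some quotient of two
  of them, by pigeonhole. So finitely many centralizers cover \<open>F\<close>, one of them has
  finite index by the covering lemma, and the corresponding quotient would lie in \<open>A1\<close>.
  The bound \<open>d\<close> must be common to all \<open>f\<close>, as it fixes the length of the
  tuple.\<close>

lemma almost_centralizer_symmetry:
  assumes "B \<lhd> G" "subgroup A G" "subgroup F G"
    and d: "\<And>f. f \<in> F \<Longrightarrow> index_le A (cent {f} B) d"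
    and A1: "subgroup A1 G" "\<And>a. a \<in> A \<Longrightarrow> \<exists>n. index_le F (cent {a} B) n \<Longrightarrow> a \<in> A1"
  shows "index_le A A1 d"
proof (rule ccontr)
  interpret A: subgroup A G by (rule assms(2))
  interpret F: subgroup F G by (rule assms(3))
  assume "\<not> index_le A A1 d"
  then obtain r :: "nat \<Rightarrow> 'a" where r: "r ` {..d} \<subseteq> A"
    "\<And>i j. i \<le> d \<Longrightarrow> j \<le> d \<Longrightarrow> i \<noteq> j \<Longrightarrow> inv (r i) \<otimes> r j \<notin> A1"
    using index_le_tupleI [OF A1(1) A.subset] by blast
  define P where "P = {(i, j). i \<le> d \<and> j \<le> d \<and> i \<noteq> j}"
  have finP: "finite P" by (rule finite_subset [of _ "{..d} \<times> {..d}"]) (auto simp: P_def)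
  have rA: "inv (r i) \<otimes> r j \<in> A" if "(i, j) \<in> P" for i j
    using that r(1) by (auto simp: P_def image_subset_iff)
  let ?\<H> = "(\<lambda>(i, j). cent {inv (r i) \<otimes> r j} B) ` P"
  have "\<exists>H\<in>?\<H>. \<exists>n. index_le F H n"
  proof (rule coset_covering [where T = "{\<one>}"])
    show "subgroup H G" if "H \<in> ?\<H>" for H
      using that rA assms(1) by (auto intro!: cent_subgroup A.mem_carrier)
    fix f assume f: "f \<in> F"
    obtain i j where ij: "(i, j) \<in> P" "inv (r i) \<otimes> r j \<in> cent {f} B"
      using index_le_tupleD [OF d [OF f] r(1)] by (auto simp: P_def)
    then have "f \<in> cent {inv (r i) \<otimes> r j} B"
      using f assms(1) comm_sym rA [OF ij(1)] by (auto simp: cent_def)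
    then show "\<exists>H\<in>?\<H>. \<exists>t\<in>{\<one>}. inv t \<otimes> f \<in> H" using ij f by force
  qed (use finP assms in auto)
  then obtain i j where "(i, j) \<in> P" "\<exists>n. index_le F (cent {inv (r i) \<otimes> r j} B) n" by auto
  then have "inv (r i) \<otimes> r j \<in> A1" using A1(2) rA by blast
  then show False using r(2) \<open>(i, j) \<in> P\<close> by (auto simp: P_def)
qed

subsection \<open>Almost centralizers\<close>

text \<open>No common bound on the index is demanded, so that products of two elements stay inside;
  a common bound is derived from the chain condition in \<open>acent_definable\<close>.\<close>

definition acent :: "'a set \<Rightarrow> 'a set \<Rightarrow> 'a set" where
  "acent M B = {g \<in> carrier G. \<exists>n. index_le M (cent {g} B) n}"

text \<open>The orbit-stabilizer principle modulo \<open>B\<close>: conjugates of \<open>s\<close>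
  by \<open>a\<close> and \<open>b\<close> agree modulo \<open>B\<close> only if
  \<open>inv a \<otimes> b\<close> centralizes \<open>s\<close> modulo \<open>B\<close>.\<close>

lemma index_le_orbit:
  assumes B: "B \<lhd> G" and s: "s \<in> carrier G" and "E \<subseteq> carrier G"
    and fin: "finite ((\<lambda>f. B #> (f \<otimes> s \<otimes> inv f)) ` E)"
  shows "\<exists>n. index_le E (cent {s} B) n"
proof -
  have "index_le E (cent {s} B) (card ((\<lambda>f. B #> (f \<otimes> s \<otimes> inv f)) ` E))"
  proof (rule index_leI [OF fin])
    fix a b assume ab: "a \<in> E" "b \<in> E" "B #> (a \<otimes> s \<otimes> inv a) = B #> (b \<otimes> s \<otimes> inv b)"
    then have c: "a \<in> carrier G" "b \<in> carrier G" using assms by auto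
    have "inv (a \<otimes> s \<otimes> inv a) \<otimes> (b \<otimes> s \<otimes> inv b) \<in> B"
      using ab c s quotient_eq_iff [OF B] by simp
    then have "inv a \<otimes> (inv (a \<otimes> s \<otimes> inv a) \<otimes> (b \<otimes> s \<otimes> inv b)) \<otimes> a \<in> B"
      using c B normal_conj' by blast
    then have "inv s \<otimes> comm (inv a \<otimes> b) s \<otimes> s \<in> B"
      using c s by (simp add: comm_def word_simps)
    then have "s \<otimes> (inv s \<otimes> comm (inv a \<otimes> b) s \<otimes> s) \<otimes> inv s \<in> B"
      using s B normal_conj by blast
    then have "comm (inv a \<otimes> b) s \<in> B" using c s by (simp add: word_simps)
    then show "inv a \<otimes> b \<in> cent {s} B" using c by (simp add: cent_def)
  qed simp
  then show ?thesis by blast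
qed

lemma acent_normal:
  assumes B: "B \<lhd> G" and M: "M \<lhd> G"
  shows "acent M B \<lhd> G"
proof (rule normal_invI)
  show "subgroup (acent M B) G"
  proof (rule subgroupI)
    have "index_le M (cent {\<one>} B) 1"
      unfolding index_le_def
    proof (intro exI [of _ "\<lambda>_. 0"] conjI ballI impI)
    show "(\<lambda>_. 0) ` M \<subseteq> {..<1::nat}" by auto
      fix a b assume ab: "a \<in> M" "b \<in> M"
      have c: "a \<in> carrier G" "b \<in> carrier G" using ab M normal_sub by blast+
      then have "comm (inv a \<otimes> b) \<one> = \<one>" by (simp add: comm_def word_simps)
      then show "inv a \<otimes> b \<in> cent {\<one>} B" using c normal_one [OF B] by (simp add: cent_def)
    qed
    then show "acent M B \<noteq> {}" unfolding acent_def by blast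
  next
    fix a assume a: "a \<in> acent M B"
    have "cent {a} B \<subseteq> cent {inv a} B"
    proof
      fix x assume x: "x \<in> cent {a} B"
      have ac: "a \<in> carrier G" using a by (simp add: acent_def)
      have "a \<in> cent {x} B" using x ac comm_sym [OF B] by (auto simp: cent_def)
      then have "inv a \<in> cent {x} B"
        using cent_subgroup [OF B, of "{x}"] x cent_closed
        by (meson empty_subsetI insert_subset subgroup.m_inv_closed)
      then show "x \<in> cent {inv a} B" using x ac comm_sym [OF B] by (auto simp: cent_def)
    qed
    then show "inv a \<in> acent M B"
      using a index_le_mono [OF _ order_refl] unfolding acent_def by blast
  next
    fix a b assume ab: "a \<in> acent M B" "b \<in> acent M B"
    have abc: "a \<in> carrier G" "b \<in> carrier G" using ab by (auto simp: acent_def)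
    have sub: "cent {a} B \<inter> cent {b} B \<subseteq> cent {a \<otimes> b} B"
    proof
      fix x assume x: "x \<in> cent {a} B \<inter> cent {b} B"
      then have "a \<in> cent {x} B" "b \<in> cent {x} B"
        using abc comm_sym [OF B] by (auto simp: cent_def)
      then have "a \<otimes> b \<in> cent {x} B"
        using cent_subgroup [OF B, of "{x}"] x cent_closed
        by (meson IntD1 empty_subsetI insert_subset subgroup.m_closed)
      then show "x \<in> cent {a \<otimes> b} B" using x abc comm_sym [OF B] by (auto simp: cent_def)
    qed
    obtain m n where "index_le M (cent {a} B) m" "index_le M (cent {b} B) n"
      using ab by (auto simp: acent_def)
    then have "index_le M (cent {a \<otimes> b} B) (m * n)"
      by (rule index_le_mono [OF index_le_Int order_refl sub])
    then show "a \<otimes> b \<in> acent M B" using abc unfolding acent_def by blast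
  qed (auto simp: acent_def)
next
  fix g h assume g: "g \<in> carrier G" and h: "h \<in> acent M B"
  have hc: "h \<in> carrier G" using h by (simp add: acent_def)
  obtain n where "index_le M (cent {h} B) n" using h by (auto simp: acent_def)
  then obtain \<phi> :: "'a \<Rightarrow> nat" where \<phi>: "\<phi> ` M \<subseteq> {..<n}"
    "\<And>a b. a \<in> M \<Longrightarrow> b \<in> M \<Longrightarrow> \<phi> a = \<phi> b \<Longrightarrow> inv a \<otimes> b \<in> cent {h} B"
    by (rule index_leE) blast
  have "index_le M (cent {g \<otimes> h \<otimes> inv g} B) n"
    unfolding index_le_def
  proof (intro exI [of _ "\<lambda>a. \<phi> (inv g \<otimes> a \<otimes> g)"] conjI ballI impI)
    show "(\<lambda>a. \<phi> (inv g \<otimes> a \<otimes> g)) ` M \<subseteq> {..<n}"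
      using \<phi>(1) normal_conj' [OF M _ g] by auto
    fix a b assume ab: "a \<in> M" "b \<in> M" "\<phi> (inv g \<otimes> a \<otimes> g) = \<phi> (inv g \<otimes> b \<otimes> g)"
    have c: "a \<in> carrier G" "b \<in> carrier G" using ab M normal_sub by blast+
    have "inv (inv g \<otimes> a \<otimes> g) \<otimes> (inv g \<otimes> b \<otimes> g) \<in> cent {h} B"
      using ab normal_conj' [OF M _ g] \<phi>(2) by blast
    then have "comm (inv g \<otimes> (inv a \<otimes> b) \<otimes> g) h \<in> B"
      using c g by (simp add: cent_def word_simps)
    then have "g \<otimes> comm (inv g \<otimes> (inv a \<otimes> b) \<otimes> g) h \<otimes> inv g \<in> B"
      using normal_conj [OF B] g by blast
    then have "comm (inv a \<otimes> b) (g \<otimes> h \<otimes> inv g) \<in> B"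
      using c g hc by (simp add: comm_def word_simps)
    then show "inv a \<otimes> b \<in> cent {g \<otimes> h \<otimes> inv g} B" using c by (simp add: cent_def)
  qed
  then show "g \<otimes> h \<otimes> inv g \<in> acent M B" using g hc unfolding acent_def by blast
qed

lemma cent_subset_acent:
  assumes B: "B \<lhd> G" and M: "M \<lhd> G"
  shows "cent M B \<subseteq> acent M B"
proof
  fix g assume g: "g \<in> cent M B"
  have "index_le M (cent {g} B) 1"
    unfolding index_le_def
  proof (intro exI [of _ "\<lambda>_. 0"] conjI ballI impI)
    show "(\<lambda>_. 0) ` M \<subseteq> {..<1::nat}" by auto
    fix a b assume ab: "a \<in> M" "b \<in> M"
    then have "inv a \<otimes> b \<in> M" using M normal_inv normal_mult by blast
    then show "inv a \<otimes> b \<in> cent {g} B"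
      using g comm_sym [OF B] normal_sub [OF M] by (auto simp: cent_def)
  qed
  then show "g \<in> acent M B" using g unfolding acent_def cent_def by blast
qed

end

text \<open>Hides the construction of the quotient: later calculations modulo \<open>B\<close> take
  place in an arbitrary group \<open>H\<close>, not with products of cosets.\<close>

lemma (in group) quotientE:
  assumes "B \<lhd> G"
  obtains H :: "'a set monoid" and h where "group_hom G H h"
    "\<And>x. x \<in> carrier G \<Longrightarrow> x \<in> B \<longleftrightarrow> h x = \<one>\<^bsub>H\<^esub>"
  using quotient_hom [OF assms] quotient_one_iff [OF assms] that by blast

section \<open>Commutator identities to be applied in quotients\<close>

lemma (in group_hom) hom_comm:
  "x \<in> carrier G \<Longrightarrow> y \<in> carrier G \<Longrightarrow> h (G.comm x y) = H.comm (h x) (h y)"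
  by (simp add: G.comm_def H.comm_def)

lemma (in group) normal_cong:
  assumes "B \<lhd> G" "U \<lhd> G" "B \<subseteq> U" "x \<in> carrier G" "y \<in> carrier G" "B #> x = B #> y" "x \<in> U"
  shows "y \<in> U"
proof -
  have "inv x \<otimes> y \<in> U" using assms quotient_eq_iff by blast
  then have "x \<otimes> (inv x \<otimes> y) \<in> U" using assms normal_mult by blast
  then show ?thesis using assms by simp
qed

text \<open>If conjugations by \<open>z\<close> and \<open>f\<close> commute on \<open>x\<close>,
  then conjugation by \<open>f\<close> respects the map sending \<open>a\<close> to
  \<open>[a, z]\<close>. This is the source of equivariance in
  \<open>abelian_nilpotent_action\<close>.\<close>

lemma (in group) comm_eq_commuting_conj:
  assumes c: "x \<in> carrier G" "z \<in> carrier G" "f \<in> carrier G"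
    and eq: "z \<otimes> (f \<otimes> x \<otimes> inv f) \<otimes> inv z = f \<otimes> (z \<otimes> x \<otimes> inv z) \<otimes> inv f"
  shows "f \<otimes> comm x z \<otimes> inv f = comm (f \<otimes> x \<otimes> inv f) z"
proof -
  have "f \<otimes> comm x z \<otimes> inv f = (f \<otimes> x \<otimes> inv f) \<otimes> inv (f \<otimes> (z \<otimes> x \<otimes> inv z) \<otimes> inv f)"
    using c by (simp add: comm_def word_simps)
  also have "\<dots> = (f \<otimes> x \<otimes> inv f) \<otimes> inv (z \<otimes> (f \<otimes> x \<otimes> inv f) \<otimes> inv z)" by (simp add: eq)
  finally show ?thesis using c by (simp add: comm_def word_simps)
qed

text \<open>Written additively, \<open>[x, f]\<close> is \<open>(1 - f) x\<close>, and commuting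
  operators satisfy \<open>(1 - z)(1 - f) = (1 - f)(1 - z)\<close>.\<close>

lemma (in group) comm_comm_swap:
  assumes c: "x \<in> carrier G" "z \<in> carrier G" "f \<in> carrier G"
    and eq: "z \<otimes> (f \<otimes> x \<otimes> inv f) \<otimes> inv z = f \<otimes> (z \<otimes> x \<otimes> inv z) \<otimes> inv f"
    and A: "x \<in> A" "f \<otimes> x \<otimes> inv f \<in> A" "z \<otimes> x \<otimes> inv z \<in> A" "f \<otimes> (z \<otimes> x \<otimes> inv z) \<otimes> inv f \<in> A"
    and comm: "\<And>a b. a \<in> A \<Longrightarrow> b \<in> A \<Longrightarrow> a \<otimes> b = b \<otimes> a"
    and inv: "\<And>a. a \<in> A \<Longrightarrow> inv a \<in> A" and AG: "A \<subseteq> carrier G"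
  shows "comm (comm x f) z = comm (comm x z) f"
proof -
  define a b s where abs: "a = f \<otimes> x \<otimes> inv f" "b = z \<otimes> x \<otimes> inv z"
    "s = f \<otimes> (z \<otimes> x \<otimes> inv z) \<otimes> inv f"
  have absc: "a \<in> carrier G" "b \<in> carrier G" "s \<in> carrier G" using c by (auto simp: abs)
  have absA: "a \<in> A" "b \<in> A" "s \<in> A" using A by (auto simp: abs)
  have "comm (comm x f) z = x \<otimes> inv a \<otimes> (z \<otimes> a \<otimes> inv z) \<otimes> inv b"
    using c by (simp add: comm_def word_simps abs)
  also have "z \<otimes> a \<otimes> inv z = s" using eq by (simp add: abs)
  also have "x \<otimes> inv a \<otimes> s \<otimes> inv b = x \<otimes> (inv a \<otimes> (s \<otimes> inv b))"
    using c absc by (simp add: m_assoc)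
  also have "inv a \<otimes> (s \<otimes> inv b) = inv b \<otimes> (s \<otimes> inv a)"
  proof -
    have "inv a \<otimes> (s \<otimes> inv b) = s \<otimes> (inv a \<otimes> inv b)"
      using comm [of "inv a" s] inv absA absc by (simp add: m_assoc [symmetric])
    also have "inv a \<otimes> inv b = inv b \<otimes> inv a" using comm inv absA by blast
    also have "s \<otimes> (inv b \<otimes> inv a) = inv b \<otimes> (s \<otimes> inv a)"
      using comm [of "inv b" s] inv absA absc by (simp add: m_assoc [symmetric])
    finally show ?thesis .
  qed
  also have "x \<otimes> (inv b \<otimes> (s \<otimes> inv a)) = comm (comm x z) f"
    using c by (simp add: comm_def word_simps abs)
  finally show ?thesis .
qed

text \<open>Under these commutation rules \<open>x f\<close> and \<open>f x\<close> conjugate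
  \<open>u\<close> to the same element, so
  \<open>inv (f \<otimes> x) \<otimes> (x \<otimes> f)\<close>, which is the commutator of the
  inverses, centralizes \<open>u\<close>.\<close>

lemma (in group) comm_inverse_centralizes:
  assumes c: "x \<in> carrier G" "f \<in> carrier G" "u \<in> carrier G" "a \<in> carrier G" "b \<in> carrier G"
    and x: "x \<otimes> u = a \<otimes> u \<otimes> x" and f: "f \<otimes> u = b \<otimes> u \<otimes> f"
    and comm: "a \<otimes> f = f \<otimes> a" "x \<otimes> b = b \<otimes> x" "a \<otimes> b = b \<otimes> a"
  shows "comm (inv x) (inv f) \<otimes> u = u \<otimes> comm (inv x) (inv f)"
proof -
  define g where "g = b \<otimes> a \<otimes> u"
  have gc: "g \<in> carrier G" using c by (simp add: g_def)
  have "x \<otimes> (f \<otimes> u) = (x \<otimes> b) \<otimes> (u \<otimes> f)" using c by (simp add: f m_assoc)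
  also have "\<dots> = b \<otimes> (x \<otimes> u) \<otimes> f" using c by (simp add: comm m_assoc)
  finally have xf: "x \<otimes> f \<otimes> u = g \<otimes> (x \<otimes> f)" using c by (simp add: x g_def m_assoc)
  have "f \<otimes> (x \<otimes> u) = (f \<otimes> a) \<otimes> (u \<otimes> x)" using c by (simp add: x m_assoc)
  also have "\<dots> = a \<otimes> (f \<otimes> u) \<otimes> x" using c by (simp add: comm(1) [symmetric] m_assoc)
  also have "\<dots> = (a \<otimes> b) \<otimes> (u \<otimes> f \<otimes> x)" using c by (simp add: f m_assoc)
  finally have fx: "f \<otimes> x \<otimes> u = g \<otimes> (f \<otimes> x)" using c by (simp add: comm(3) g_def m_assoc)
  have "comm (inv x) (inv f) \<otimes> u = inv (f \<otimes> x) \<otimes> (x \<otimes> f \<otimes> u)"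
    using c by (simp add: comm_def word_simps)
  also have "\<dots> = inv (f \<otimes> x) \<otimes> (g \<otimes> (f \<otimes> x)) \<otimes> inv (f \<otimes> x) \<otimes> (x \<otimes> f)"
    using c gc by (simp add: xf word_simps)
  also have "\<dots> = u \<otimes> comm (inv x) (inv f)"
    using c unfolding fx [symmetric] by (simp add: comm_def word_simps)
  finally show ?thesis .
qed

section \<open>Nilpotent action under the chain condition\<close>

text \<open>
  The predicate \<open>dfn\<close> abstracts definability, and \<open>F\<close> the Fitting subgroup.
\<close>

locale almost_centralizer_group = group G for G :: "('a, 'b) monoid_scheme" (structure) +
  fixes F :: "'a set" and dfn :: "'a set \<Rightarrow> bool"
  assumes F_normal: "F \<lhd> G"
    and F_local: "finite S \<Longrightarrow> S \<subseteq> F \<Longrightarrow> \<exists>N c. N \<lhd> G \<and> S \<subseteq> N \<and> carrier G \<subseteq> up N c {\<one>}"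
    and dfn_one: "dfn {\<one>}"
    and dfn_almost: "dfn B \<Longrightarrow> B \<lhd> G \<Longrightarrow> finite S \<Longrightarrow> S \<subseteq> carrier G \<Longrightarrow>
      dfn {g \<in> carrier G. index_le (cent S B) (cent {g} B) d}"
    and chain: "dfn B \<Longrightarrow> B \<lhd> G \<Longrightarrow>
      \<exists>d. \<forall>S\<subseteq>carrier G. \<exists>S0\<subseteq>S. finite S0 \<and> (\<forall>g\<in>S. index_le (cent S0 B) (cent {g} B) d)"
begin

lemma F_sub: "x \<in> F \<Longrightarrow> x \<in> carrier G"
  using F_normal normal_sub by blast

lemma F_subset: "F \<subseteq> carrier G"
  using F_normal normal_subset by blast

text \<open>Write \<open>f = r k\<close> with \<open>r\<close> in a finite set of representatives
  and \<open>k\<close> in \<open>K\<close>. For \<open>x\<close> centralizing \<open>K\<close>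
  modulo \<open>B\<close>, \<open>[x, f]\<close> agrees with \<open>[x, r]\<close> up to a factor in
  \<open>B\<close>, and all \<open>r\<close> lie in one normal \<open>N\<close> acting nilpotently
  on \<open>G\<close>. Invariance of \<open>K\<close> keeps \<open>[x, r]\<close> in
  \<open>cent K B\<close>, so the argument repeats.\<close>

lemma cent_subset_up:
  assumes K: "K \<subseteq> carrier G" "\<And>f k. f \<in> F \<Longrightarrow> k \<in> K \<Longrightarrow> inv f \<otimes> k \<otimes> f \<in> K"
    and "index_le F K n"
  shows "\<exists>c. \<forall>B. B \<lhd> G \<longrightarrow> cent K B \<subseteq> up F c B"
proof -
  obtain R where R: "finite R" "R \<subseteq> F" "\<And>f. f \<in> F \<Longrightarrow> \<exists>r\<in>R. inv r \<otimes> f \<in> K"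
    using index_le_cover [OF assms(3)] by metis
  obtain N c where N: "N \<lhd> G" "R \<subseteq> N" "carrier G \<subseteq> up N c {\<one>}"
    using F_local [OF R(1,2)] by blast
  have "cent K B \<subseteq> up F c B" if B: "B \<lhd> G" for B
  proof -
    have "cent K B \<inter> up N i B \<subseteq> up F i B" for i
    proof (induction i)
      case (Suc i)
      show ?case
      proof
        fix x assume x: "x \<in> cent K B \<inter> up N (Suc i) B"
        then have xc: "x \<in> carrier G" using cent_closed by blast
        have "comm x f \<in> up F i B" if f: "f \<in> F" for f
        proof -
          obtain r where r: "r \<in> R" "inv r \<otimes> f \<in> K" using R(3) f by blast
          have rc: "r \<in> F" "r \<in> carrier G" "r \<in> N" "f \<in> carrier G"
            using r R(2) N(2) F_sub f by auto
          let ?k = "inv r \<otimes> f"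
          have "comm x f = comm x (r \<otimes> ?k)" using rc by simp
          also have "\<dots> = comm x r \<otimes> (r \<otimes> comm x ?k \<otimes> inv r)"
            using rc xc by (intro comm_mult_right) auto
          finally have eq: "comm x f = comm x r \<otimes> (r \<otimes> comm x ?k \<otimes> inv r)" .
          interpret X: subgroup "cent K B" G using B K(1) by (rule cent_subgroup)
          have "r \<otimes> inv x \<otimes> inv r \<in> cent K B"
            using x rc K B by (intro cent_conj) auto
          then have "x \<otimes> (r \<otimes> inv x \<otimes> inv r) \<in> cent K B" using x by blast
          then have "comm x r \<in> cent K B" using xc rc by (simp add: comm_def word_simps)
          moreover have "comm x r \<in> up N i B" using x rc centD [of x N "up N i B" r] by simp
          ultimately have "comm x r \<in> up F i B" using Suc by blast
          moreover have "comm x ?k \<in> B" using x r centD by blast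
          then have "r \<otimes> comm x ?k \<otimes> inv r \<in> up F i B"
            using B rc normal_conj up_increasing [OF B F_normal] by blast
          ultimately show ?thesis
            unfolding eq using normal_mult [OF up_normal [OF B F_normal]] by blast
        qed
        then show "x \<in> up F (Suc i) B" using xc by (simp add: cent_def)
      qed
    qed simp
    moreover have "cent K B \<subseteq> up N c B"
      using N(3) up_mono [of "{\<one>}" B c N] normal_one [OF B] cent_subset by blast
    ultimately show ?thesis by blast
  qed
  then show ?thesis by blast
qed

text \<open>Each element of \<open>S\<close> has a finite \<open>F\<close>-orbit modulo
  \<open>B\<close>, and \<open>S\<close> has finitely many classes modulo \<open>B\<close>, so a
  subgroup \<open>K\<close> of finite index in \<open>F\<close> centralizes \<open>S\<close> modulo
  \<open>B\<close>; then \<open>cent_subset_up\<close> applies. \<open>S\<close> need not be a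
  subgroup, which suits sets of commutators.\<close>

lemma finite_invariant_subset_up:
  assumes B: "B \<lhd> G" and S: "S \<subseteq> carrier G"
    and inv: "\<And>f s. f \<in> F \<Longrightarrow> s \<in> S \<Longrightarrow> f \<otimes> s \<otimes> inv f \<in> S"
    and fin: "finite ((\<lambda>s. B #> s) ` S)"
  shows "\<exists>n. S \<subseteq> up F n B"
proof -
  interpret F: subgroup F G using F_normal by (rule normal_imp_subgroup)
  obtain T where T: "finite T" "T \<subseteq> S" "(\<lambda>s. B #> s) ` S = (\<lambda>s. B #> s) ` T"
    using finite_subset_image [OF fin order_refl] by metis
  have "\<exists>n. index_le F (cent {s} B) n" if s: "s \<in> S" for s
  proof (rule index_le_orbit [OF B])
    have "(\<lambda>f. B #> (f \<otimes> s \<otimes> inv f)) ` F \<subseteq> (\<lambda>s. B #> s) ` S" using inv s by auto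
    then show "finite ((\<lambda>f. B #> (f \<otimes> s \<otimes> inv f)) ` F)" using fin finite_subset by blast
  qed (use s S F_subset in auto)
  then have "\<exists>n. index_le F (\<Inter>s\<in>T. cent {s} B) n"
    using T by (intro index_le_finite_Int) auto
  then obtain n where n: "index_le F (\<Inter>s\<in>T. cent {s} B) n" by blast
  define K where "K = F \<inter> cent S B"
  have TK: "F \<inter> (\<Inter>s\<in>T. cent {s} B) \<subseteq> K"
  proof
    fix f assume f: "f \<in> F \<inter> (\<Inter>s\<in>T. cent {s} B)"
    have "comm f s \<in> B" if s: "s \<in> S" for s
    proof -
      obtain t where t: "t \<in> T" "B #> s = B #> t" using T(3) s by (metis imageE imageI)
      then have "comm f t \<in> B" using f by (auto simp: cent_def)
      then show ?thesis
        using comm_in_iff [OF B, of f s] comm_in_iff [OF B, of f t] t s S f T(2) F_sub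
        by (metis (no_types, lifting) IntD1 subsetD)
    qed
    then show "f \<in> K" using f F_sub by (auto simp: K_def cent_def)
  qed
  have idx: "index_le F K n"
    unfolding index_le_def
  proof -
    obtain \<phi> :: "'a \<Rightarrow> nat" where \<phi>: "\<phi> ` F \<subseteq> {..<n}"
      "\<And>a b. a \<in> F \<Longrightarrow> b \<in> F \<Longrightarrow> \<phi> a = \<phi> b \<Longrightarrow> inv a \<otimes> b \<in> (\<Inter>s\<in>T. cent {s} B)"
      using n by (rule index_leE) blast
    have "inv a \<otimes> b \<in> K" if "a \<in> F" "b \<in> F" "\<phi> a = \<phi> b" for a b
      using \<phi>(2) [OF that] TK F.m_closed [OF F.m_inv_closed [OF that(1)] that(2)] by blast
    then show "\<exists>\<phi>::'a \<Rightarrow> nat. \<phi> ` F \<subseteq> {..<n} \<and> (\<forall>a\<in>F. \<forall>b\<in>F. \<phi> a = \<phi> b \<longrightarrow> inv a \<otimes> b \<in> K)"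
      using \<phi>(1) by blast
  qed
  have Kc: "K \<subseteq> carrier G" using F_subset by (auto simp: K_def)
  have Kinv: "inv f \<otimes> k \<otimes> f \<in> K" if "f \<in> F" "k \<in> K" for f k
  proof -
    have "inv f \<otimes> k \<otimes> inv (inv f) \<in> cent S B"
    proof (rule cent_conj [OF B _ _ S])
      fix y assume "y \<in> S"
      then show "inv (inv f) \<otimes> y \<otimes> inv f \<in> S" using inv that(1) F_sub by simp
    qed (use that F_sub in \<open>auto simp: K_def\<close>)
    moreover have "inv f \<otimes> k \<otimes> f \<in> F" using that F_normal F_sub by (auto simp: K_def)
    ultimately show ?thesis using that F_sub by (simp add: K_def)
  qed
  obtain c where c: "cent K B \<subseteq> up F c B" using cent_subset_up [OF Kc Kinv idx] B by blast
  have "S \<subseteq> cent K B"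
    using comm_sym [OF B] S F_sub by (auto simp: cent_def K_def subset_iff)
  then show ?thesis using c by blast
qed

text \<open>Apply the chain condition to the family \<open>acent M B\<close> itself.
  \<open>M\<close> meets the centralizer of the resulting finite \<open>S\<close> in index at most
  some \<open>n\<close>, so membership amounts to index at most \<open>d\<close> relative to
  \<open>cent S B\<close>, where \<open>M\<close> no longer occurs; \<open>n * d\<close> is then a
  common bound for \<open>M\<close>.\<close>

lemma acent_definable:
  assumes B: "dfn B" "B \<lhd> G" and M: "M \<lhd> G"
  shows "dfn (acent M B)" "\<exists>e. \<forall>g\<in>acent M B. index_le M (cent {g} B) e"
proof -
  have sub: "acent M B \<subseteq> carrier G" by (auto simp: acent_def)
  obtain d S where S: "S \<subseteq> acent M B" "finite S"
    "\<And>g. g \<in> acent M B \<Longrightarrow> index_le (cent S B) (cent {g} B) d"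
    using chain [OF B] sub by metis
  have "\<exists>n. index_le M (\<Inter>s\<in>S. cent {s} B) n"
    using S by (intro index_le_finite_Int) (auto simp: acent_def)
  then obtain n where "index_le M (\<Inter>s\<in>S. cent {s} B) n" by blast
  then obtain \<phi> :: "'a \<Rightarrow> nat" where \<phi>: "\<phi> ` M \<subseteq> {..<n}"
    "\<And>a b. a \<in> M \<Longrightarrow> b \<in> M \<Longrightarrow> \<phi> a = \<phi> b \<Longrightarrow> inv a \<otimes> b \<in> (\<Inter>s\<in>S. cent {s} B)"
    by (rule index_leE) blast
  have "inv a \<otimes> b \<in> cent S B" if "a \<in> M" "b \<in> M" "\<phi> a = \<phi> b" for a b
    using \<phi>(2) [OF that] that normal_sub [OF M] by (auto simp: cent_def)
  then have n: "index_le M (cent S B) n" unfolding index_le_def using \<phi>(1) by blast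
  have tr: "index_le M (cent {g} B) (n * d)" if "index_le (cent S B) (cent {g} B) d" for g
    using index_le_trans [OF n that] normal_subset [OF M] by blast
  have "acent M B = {g \<in> carrier G. index_le (cent S B) (cent {g} B) d}"
    using S(3) tr by (auto simp: acent_def)
  moreover have "S \<subseteq> carrier G" using S(1) sub by blast
  ultimately show "dfn (acent M B)" using dfn_almost [OF B S(2)] by metis
  show "\<exists>e. \<forall>g\<in>acent M B. index_le M (cent {g} B) e" using S(3) tr by blast
qed

text \<open>
  Boundedness of the indices is known only for the elements of \<open>M \<inter> acent M B\<close>; passing to
  the finite-index subgroup \<open>M1\<close> provides the other finiteness condition in
  \<open>finite_commutators\<close>.
\<close>

lemma acent_Int_commutators:
  assumes B: "dfn B" "B \<lhd> G" and M: "M \<lhd> G" "M \<subseteq> F"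
  shows "\<exists>M1 e k. M1 \<lhd> G \<and> M1 \<subseteq> M \<and> M \<inter> acent M B \<subseteq> M1 \<and> index_le M M1 e \<and>
    M \<inter> acent M B \<subseteq> cent M1 (up F k B)"
proof -
  define Q where "Q = M \<inter> acent M B"
  have Q: "Q \<lhd> G" unfolding Q_def by (intro normal_subgroup_intersect M acent_normal B)
  define M1 where "M1 = M \<inter> acent Q B"
  have M1: "M1 \<lhd> G" unfolding M1_def by (intro normal_subgroup_intersect M acent_normal B Q)
  obtain e where e: "\<And>g. g \<in> acent M B \<Longrightarrow> index_le M (cent {g} B) e"
    using acent_definable [OF B M(1)] by blast
  have "Q \<subseteq> acent Q B"
    using index_le_mono [of M _ _ Q] by (auto simp: Q_def acent_def)
  then have QM1: "Q \<subseteq> M1" by (auto simp: M1_def Q_def)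
  \<comment> \<open>All of \<open>Q\<close> almost centralizes \<open>M\<close> with the common
    bound \<open>e\<close>; by symmetry, the elements of \<open>M\<close> almost centralizing
    \<open>Q\<close> have index at most \<open>e\<close>.\<close>
  have idx: "index_le M M1 e"
  proof (rule almost_centralizer_symmetry [OF B(2)])
    show "subgroup M G" "subgroup Q G" "subgroup M1 G"
      using M Q M1 normal_imp_subgroup by blast+
    show "index_le M (cent {f} B) e" if "f \<in> Q" for f using that e by (simp add: Q_def)
    show "a \<in> M1" if "a \<in> M" "\<exists>n. index_le Q (cent {a} B) n" for a
      using that normal_sub [OF M(1)] by (auto simp: M1_def acent_def)
  qed
  have fin: "finite ((\<lambda>(n, x). B #> comm n x) ` (M1 \<times> Q))"
  proof (rule finite_commutators [OF B(2)])
    show "subgroup M1 G" "subgroup Q G" using Q M1 normal_imp_subgroup by blast+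
    show "index_le M1 (cent {x} B) e" if "x \<in> Q" for x
      using that e index_le_mono [of M _ e M1] by (auto simp: Q_def M1_def)
    show "\<exists>k. index_le Q (cent {n} B) k" if "n \<in> M1" for n
      using that by (auto simp: M1_def acent_def)
  qed
  \<comment> \<open>The bare set of commutators suffices: it is finite modulo \<open>B\<close>, and
    normality of \<open>M1\<close> and \<open>Q\<close> makes it invariant under
    conjugation.\<close>
  define S where "S = (\<lambda>(n, x). comm n x) ` (M1 \<times> Q)"
  have c: "M1 \<subseteq> carrier G" "Q \<subseteq> carrier G" using M1 Q normal_subset by blast+
  have "\<exists>k. S \<subseteq> up F k B"
  proof (rule finite_invariant_subset_up [OF B(2)])
    show "S \<subseteq> carrier G" using c by (auto simp: S_def)
    have "(\<lambda>s. B #> s) ` S = (\<lambda>(n, x). B #> comm n x) ` (M1 \<times> Q)"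
      by (auto simp: S_def image_iff)
    then show "finite ((\<lambda>s. B #> s) ` S)" using fin by simp
    fix f s assume f: "f \<in> F" and "s \<in> S"
    then obtain n x where s: "n \<in> M1" "x \<in> Q" "s = comm n x" by (auto simp: S_def)
    have "f \<otimes> s \<otimes> inv f = comm (f \<otimes> n \<otimes> inv f) (f \<otimes> x \<otimes> inv f)"
      using s c f F_sub by (simp add: comm_conj subset_iff)
    moreover have "f \<otimes> n \<otimes> inv f \<in> M1" "f \<otimes> x \<otimes> inv f \<in> Q"
      using s f F_sub normal_conj [OF M1] normal_conj [OF Q] by blast+
    ultimately show "f \<otimes> s \<otimes> inv f \<in> S" by (auto simp: S_def)
  qed
  then obtain k where k: "S \<subseteq> up F k B" by blast
  have "Q \<subseteq> cent M1 (up F k B)"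
  proof
    fix x assume x: "x \<in> Q"
    have "comm x n \<in> up F k B" if n: "n \<in> M1" for n
    proof -
      have "comm n x \<in> S" using n x by (auto simp: S_def)
      then have "comm n x \<in> up F k B" using k by blast
      then show ?thesis
        using comm_sym [OF up_normal [OF B(2) F_normal]] n x c by blast
    qed
    then show "x \<in> cent M1 (up F k B)" using x c by (auto simp: cent_def)
  qed
  then show ?thesis using M1 QM1 idx unfolding Q_def [symmetric] by (auto simp: M1_def)
qed

text \<open>With \<open>M = F\<close> the subgroup \<open>M1\<close> has finite index in
  \<open>F\<close>, so centralizing \<open>M1\<close> already gives nilpotent action of
  \<open>F\<close>, by \<open>cent_subset_up\<close>.\<close>

lemma F_Int_acent_subset_up:
  assumes B: "dfn B" "B \<lhd> G"
  shows "\<exists>k. F \<inter> acent F B \<subseteq> up F k B"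
proof -
  obtain M1 e k where M1: "M1 \<lhd> G" "index_le F M1 e" "F \<inter> acent F B \<subseteq> cent M1 (up F k B)"
    using acent_Int_commutators [OF B F_normal order_refl] by blast
  obtain c where "\<forall>B. B \<lhd> G \<longrightarrow> cent M1 B \<subseteq> up F c B"
    using cent_subset_up [OF normal_subset [OF M1(1)] _ M1(2)] normal_conj' [OF M1(1)] F_sub by blast
  then have "cent M1 (up F k B) \<subseteq> up F (c + k) B"
    using up_normal [OF B(2) F_normal] by (simp add: up_add)
  then show ?thesis using M1(3) by blast
qed

text \<open>Replace each step \<open>cent F\<close> by \<open>acent F\<close>: this is larger but
  keeps the denominators definable, and the part of it in \<open>F\<close> is still acted on
  nilpotently. The price is that \<open>k\<close> may exceed \<open>r\<close>.\<close>

lemma up_definable_hull: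
  assumes B: "dfn B" "B \<lhd> G"
  shows "\<exists>B' k. dfn B' \<and> B' \<lhd> G \<and> F \<inter> up F r B \<subseteq> B' \<and> F \<inter> B' \<subseteq> up F k B"
proof (induction r)
  case 0
  show ?case using B by (intro exI [of _ B] exI [of _ 0]) auto
next
  case (Suc r)
  then obtain B' k where B': "dfn B'" "B' \<lhd> G" "F \<inter> up F r B \<subseteq> B'" "F \<inter> B' \<subseteq> up F k B" by blast
  obtain k' where k': "F \<inter> acent F B' \<subseteq> up F k' B'" using F_Int_acent_subset_up B' by blast
  have "F \<inter> up F (Suc r) B \<subseteq> acent F B'"
  proof
    fix x assume x: "x \<in> F \<inter> up F (Suc r) B"
    then have "comm x f \<in> F \<inter> up F r B" if "f \<in> F" for f
      using that comm_in_normal_left [OF F_normal] F_sub centD [of x F "up F r B" f] by auto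
    then have "x \<in> cent F B'" using B'(3) x F_sub by (auto intro!: centI)
    then show "x \<in> acent F B'" using cent_subset_acent B'(2) F_normal by blast
  qed
  moreover have "F \<inter> acent F B' \<subseteq> up F (k' + k) B"
    using k' up_Int [OF F_normal F_subset, of k' B'] up_mono [OF B'(4), of k' F]
    by (auto simp: up_add)
  ultimately show ?case
    using acent_definable(1) [OF B'(1,2) F_normal] acent_normal [OF B'(2) F_normal] by blast
qed

text \<open>Induction on the class \<open>c\<close> of \<open>F\<close> modulo \<open>M\<close>; for
  \<open>c = 0\<close>, \<open>M = F\<close> centralizes \<open>A\<close> modulo \<open>B\<close>.
  The inductive step enlarges the denominator to an almost centralizer and shrinks \<open>A\<close>,
  so \<open>M\<close>, \<open>B\<close> and \<open>A\<close> all vary.\<close>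

lemma abelian_nilpotent_action:
  assumes "M \<lhd> G" "M \<subseteq> F" "F \<subseteq> up F c M" "dfn B" "B \<lhd> G" "subgroup A G" "A \<subseteq> F"
    and "\<And>f a. f \<in> F \<Longrightarrow> a \<in> A \<Longrightarrow> f \<otimes> a \<otimes> inv f \<in> A"
    and "A \<subseteq> cent A B" "A \<subseteq> cent M B"
  shows "\<exists>n. A \<subseteq> up F n B"
  using assms
proof (induction c arbitrary: M B A)
  case 0
  then have "A \<subseteq> cent F B" using cent_antimono [of F M B] by auto
  then show ?case by (intro exI [of _ 1]) simp
next
  case (Suc c)
  note M = Suc.prems(1,2) and B = Suc.prems(4,5) and A = Suc.prems(6,7) and Ainv = Suc.prems(8)
  interpret A: subgroup A G by (rule A(1))
  \<comment> \<open>The preimage in \<open>F\<close> of the centre of \<open>F/M\<close>; modulo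
    \<open>Z\<close> the class drops to \<open>c\<close>.\<close>
  define Z where "Z = F \<inter> cent F M"
  have Z: "Z \<lhd> G" unfolding Z_def by (intro normal_subgroup_intersect cent_normal F_normal M)
  have ZF: "Z \<subseteq> F" by (simp add: Z_def)
  have "F \<subseteq> F \<inter> up F c (cent F M)"
    using Suc.prems(3) up_add [of c 1 F M] by simp
  then have FZ: "F \<subseteq> up F c Z"
    using up_Int [OF F_normal F_subset, of c "cent F M"] by (auto simp: Z_def)
  \<comment> \<open>This \<open>S\<close> splits \<open>A\<close>: on the subgroup \<open>C\<close>
    centralizing \<open>S\<close> modulo \<open>B\<close>, every \<open>z\<close> in
    \<open>Z\<close> acts with kernel of index at most \<open>d\<close>, while on \<open>A/C\<close>
    only the finitely many elements of \<open>S\<close> matter.\<close>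
  obtain d S where S: "S \<subseteq> Z" "finite S"
    "\<And>z. z \<in> Z \<Longrightarrow> index_le (cent S B) (cent {z} B) d"
    using chain [OF B] normal_subset [OF Z] by metis
  have SF: "S \<subseteq> F" using S ZF by blast
  have SG: "S \<subseteq> carrier G" using SF F_subset by blast
  define C where "C = A \<inter> cent S B"
  obtain H :: "'a set monoid" and h where h: "group_hom G H h"
    and hB: "\<And>x. x \<in> carrier G \<Longrightarrow> x \<in> B \<longleftrightarrow> h x = \<one>\<^bsub>H\<^esub>"
    using quotientE [OF B(2)] by blast
  interpret h: group_hom G H h by (rule h)
  have h_comm_iff: "comm x y \<in> B \<longleftrightarrow> h x \<otimes>\<^bsub>H\<^esub> h y = h y \<otimes>\<^bsub>H\<^esub> h x"
    if "x \<in> carrier G" "y \<in> carrier G" for x y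
    using that hB [of "comm x y"] h.hom_comm h.H.comm_eq_one_iff [of "h x" "h y"] by simp
  have h_eq: "B #> x = B #> y" if "x \<in> carrier G" "y \<in> carrier G" "h x = h y" for x y
    using that hB [of "inv x \<otimes> y"] quotient_eq_iff [OF B(2)] by simp
  have ZA: "z \<otimes> x \<otimes> inv z \<in> A" if "z \<in> Z" "x \<in> A" for x z using that Ainv ZF by blast
  have conj_swap: "h (z \<otimes> (f \<otimes> x \<otimes> inv f) \<otimes> inv z) = h (f \<otimes> (z \<otimes> x \<otimes> inv z) \<otimes> inv f)"
    if "x \<in> A" "f \<in> F" "z \<in> Z" for x f z
  proof -
    have c: "x \<in> carrier G" "f \<in> carrier G" "z \<in> carrier G" using that F_sub ZF by auto
    \<comment> \<open>The two conjugates of \<open>x\<close> differ by conjugation with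
      \<open>[z, f]\<close>, which lies in \<open>M\<close> and so acts trivially on
      \<open>A\<close> modulo \<open>B\<close>.\<close>
    let ?w = "f \<otimes> (z \<otimes> x \<otimes> inv z) \<otimes> inv f" and ?u = "comm z f"
    have w: "?w \<in> A" using that Ainv ZA by blast
    have u: "?u \<in> M" using that by (auto simp: Z_def cent_def)
    have "comm ?w ?u \<in> B" using Suc.prems(10) w u centD by blast
    then have eq: "h ?w \<otimes>\<^bsub>H\<^esub> h ?u = h ?u \<otimes>\<^bsub>H\<^esub> h ?w"
      using h_comm_iff [of ?w ?u] c by simp
    have "z \<otimes> (f \<otimes> x \<otimes> inv f) \<otimes> inv z = ?u \<otimes> ?w \<otimes> inv ?u"
      using c by (simp add: comm_def word_simps)
    then have "h (z \<otimes> (f \<otimes> x \<otimes> inv f) \<otimes> inv z) = h (?u \<otimes> ?w \<otimes> inv ?u)" by (rule arg_cong)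
    also have "\<dots> = h ?u \<otimes>\<^bsub>H\<^esub> h ?w \<otimes>\<^bsub>H\<^esub> inv\<^bsub>H\<^esub> h ?u"
    proof -
      have wc: "?w \<in> carrier G" "?u \<in> carrier G" using c by auto
      show ?thesis by (simp only: h.hom_mult h.hom_inv wc m_closed inv_closed)
    qed
    also have "\<dots> = h ?w"
    proof -
      have wc: "h ?w \<in> carrier H" "h ?u \<in> carrier H" using c by (intro h.hom_closed; simp)+
      show ?thesis unfolding eq [symmetric] using wc by (simp only: h.H.m_assoc h.H.r_inv h.H.r_one h.H.inv_closed)
    qed
    finally show ?thesis .
  qed
  have conj_comm: "h (f \<otimes> comm x z \<otimes> inv f) = h (comm (f \<otimes> x \<otimes> inv f) z)"
    if "x \<in> A" "f \<in> F" "z \<in> Z" for x f z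
  proof -
    have c: "x \<in> carrier G" "f \<in> carrier G" "z \<in> carrier G" using that F_sub ZF by auto
    have "h f \<otimes>\<^bsub>H\<^esub> h.H.comm (h x) (h z) \<otimes>\<^bsub>H\<^esub> inv\<^bsub>H\<^esub> h f =
        h.H.comm (h f \<otimes>\<^bsub>H\<^esub> h x \<otimes>\<^bsub>H\<^esub> inv\<^bsub>H\<^esub> h f) (h z)"
      using conj_swap [OF that] c by (intro h.H.comm_eq_commuting_conj) simp_all
    then show ?thesis using c by (simp add: h.hom_comm)
  qed
  have comm_swap: "h (comm (comm x f) z) = h (comm (comm x z) f)"
    if "x \<in> A" "f \<in> F" "z \<in> Z" for x f z
  proof -
    have c: "x \<in> carrier G" "f \<in> carrier G" "z \<in> carrier G" using that F_sub ZF by auto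
    have "h.H.comm (h.H.comm (h x) (h f)) (h z) = h.H.comm (h.H.comm (h x) (h z)) (h f)"
    proof (rule h.H.comm_comm_swap [where A = "h ` A"])
      show "h z \<otimes>\<^bsub>H\<^esub> (h f \<otimes>\<^bsub>H\<^esub> h x \<otimes>\<^bsub>H\<^esub> inv\<^bsub>H\<^esub> h f) \<otimes>\<^bsub>H\<^esub> inv\<^bsub>H\<^esub> h z =
          h f \<otimes>\<^bsub>H\<^esub> (h z \<otimes>\<^bsub>H\<^esub> h x \<otimes>\<^bsub>H\<^esub> inv\<^bsub>H\<^esub> h z) \<otimes>\<^bsub>H\<^esub> inv\<^bsub>H\<^esub> h f"
        using conj_swap [OF that] c by simp
      have "h (f \<otimes> x \<otimes> inv f) \<in> h ` A" "h (z \<otimes> x \<otimes> inv z) \<in> h ` A"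
        "h (f \<otimes> (z \<otimes> x \<otimes> inv z) \<otimes> inv f) \<in> h ` A"
        using that Ainv ZA by blast+
      then show "h f \<otimes>\<^bsub>H\<^esub> h x \<otimes>\<^bsub>H\<^esub> inv\<^bsub>H\<^esub> h f \<in> h ` A" "h z \<otimes>\<^bsub>H\<^esub> h x \<otimes>\<^bsub>H\<^esub> inv\<^bsub>H\<^esub> h z \<in> h ` A"
        "h f \<otimes>\<^bsub>H\<^esub> (h z \<otimes>\<^bsub>H\<^esub> h x \<otimes>\<^bsub>H\<^esub> inv\<^bsub>H\<^esub> h z) \<otimes>\<^bsub>H\<^esub> inv\<^bsub>H\<^esub> h f \<in> h ` A"
        using c by simp_all
      show "a \<otimes>\<^bsub>H\<^esub> b = b \<otimes>\<^bsub>H\<^esub> a" if ab: "a \<in> h ` A" "b \<in> h ` A" for a b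
      proof -
        obtain x y where xy: "x \<in> A" "y \<in> A" "a = h x" "b = h y" using ab by blast
        then have "comm x y \<in> B" using centD [OF subsetD [OF Suc.prems(9)]] by simp
        then show ?thesis using xy h_comm_iff [of x y] by simp
      qed
      show "inv\<^bsub>H\<^esub> a \<in> h ` A" if a: "a \<in> h ` A" for a
      proof -
        obtain x where "x \<in> A" "a = h x" using a by blast
        then have "inv\<^bsub>H\<^esub> a = h (inv x)" "inv x \<in> A" by simp_all
        then show ?thesis by blast
      qed
    qed (use c that in auto)
    then show ?thesis using c by (simp add: h.hom_comm)
  qed
  have C: "subgroup C G"
    unfolding C_def using A(1) cent_subgroup [OF B(2) SG] by (rule subgroups_Inter_pair)
  have CA: "C \<subseteq> A" by (simp add: C_def)
  have Cinv: "f \<otimes> x \<otimes> inv f \<in> C" if "f \<in> F" "x \<in> C" for f x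
  proof -
    have c: "x \<in> carrier G" "f \<in> carrier G" using that F_sub C_def by auto
    have "comm (f \<otimes> x \<otimes> inv f) z \<in> B" if z: "z \<in> S" for z
    proof -
      have "z \<in> Z" "z \<in> carrier G" using z S SG by auto
      then have "h (comm (f \<otimes> x \<otimes> inv f) z) = h (f \<otimes> comm x z \<otimes> inv f)"
        using conj_comm [of x f z] \<open>f \<in> F\<close> \<open>x \<in> C\<close> by (simp add: C_def)
      moreover have "comm x z \<in> B" using \<open>x \<in> C\<close> z by (simp add: C_def cent_def)
      then have "f \<otimes> comm x z \<otimes> inv f \<in> B" using normal_conj [OF B(2)] c by blast
      ultimately show ?thesis using c \<open>z \<in> carrier G\<close> hB by simp
    qed
    then show ?thesis using Ainv that c by (auto simp: C_def cent_def)
  qed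
  \<comment> \<open>Elements with finite \<open>F\<close>-orbit modulo \<open>B\<close> fall into
    \<open>B'\<close>; the values \<open>[a, z]\<close> for \<open>a\<close> in \<open>C\<close>
    turn out to be of this kind.\<close>
  define B' where "B' = acent F B"
  have B': "dfn B'" "B' \<lhd> G"
    unfolding B'_def by (intro acent_definable acent_normal B F_normal)+
  have BB': "B \<subseteq> B'"
    using cent_increasing [OF B(2) F_subset] cent_subset_acent [OF B(2) F_normal] by (simp add: B'_def)
  obtain k where k: "F \<inter> B' \<subseteq> up F k B" using F_Int_acent_subset_up [OF B] by (auto simp: B'_def)
  \<comment> \<open>For \<open>z \<in> Z\<close>, the map \<open>a \<mapsto> [a, z]\<close> is \<open>F\<close>-equivariant modulo \<open>B\<close> with finite image on \<open>C\<close>.\<close>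
  have CZ: "C \<subseteq> cent Z B'"
  proof (intro subsetI centI)
    fix a z assume a: "a \<in> C" and z: "z \<in> Z"
    have c: "a \<in> carrier G" "z \<in> carrier G" using a z normal_sub [OF Z] C_def by auto
    have "index_le C (cent {z} B) d" using S(3) [OF z] index_le_mono C_def by blast
    then have fin: "finite ((\<lambda>x. B #> comm x z) ` C)"
    proof (rule index_le_image)
      fix x y assume xy: "x \<in> C" "y \<in> C" "inv x \<otimes> y \<in> cent {z} B"
      then have xyc: "x \<in> carrier G" "y \<in> carrier G" by (auto simp: C_def)
      have "comm (inv x \<otimes> y) z \<in> B" using xy(3) by (simp add: cent_def)
      then have "h (comm (inv x \<otimes> y) z) = \<one>\<^bsub>H\<^esub>" using hB xyc c by simp
      moreover have "comm y z = x \<otimes> comm (inv x \<otimes> y) z \<otimes> inv x \<otimes> comm x z"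
        using xyc c comm_mult_left [of x "inv x \<otimes> y" z] by simp
      ultimately have "h (comm y z) = h (comm x z)" using xyc c by simp
      then show "B #> comm x z = B #> comm y z" using h_eq xyc c by simp
    qed
    have "(\<lambda>f. B #> (f \<otimes> comm a z \<otimes> inv f)) ` F \<subseteq> (\<lambda>x. B #> comm x z) ` C"
    proof clarify
      fix f assume f: "f \<in> F"
      have "B #> (f \<otimes> comm a z \<otimes> inv f) = B #> comm (f \<otimes> a \<otimes> inv f) z"
        using conj_comm [of a f z] f z a c F_sub CA by (intro h_eq) auto
      then show "B #> (f \<otimes> comm a z \<otimes> inv f) \<in> (\<lambda>x. B #> comm x z) ` C" using Cinv f a by blast
    qed
    then have "finite ((\<lambda>f. B #> (f \<otimes> comm a z \<otimes> inv f)) ` F)" using fin finite_subset by blast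
    then show "comm a z \<in> B'"
      using index_le_orbit [OF B(2) _ F_subset] c unfolding B'_def acent_def by blast
  qed (auto simp: C_def)
  have "\<exists>n. C \<subseteq> up F n B'"
  proof (rule Suc.IH [OF Z ZF FZ B' C _ Cinv _ CZ])
    show "C \<subseteq> F" using CA A by blast
    have "C \<subseteq> cent A B" using Suc.prems(9) CA by blast
    also have "\<dots> \<subseteq> cent C B'" using cent_antimono [OF CA] cent_mono [OF BB'] by blast
    finally show "C \<subseteq> cent C B'" .
  qed
  then obtain n' where "C \<subseteq> up F n' B'" by blast
  then have "C \<subseteq> up F n' (F \<inter> B')"
    using up_Int [OF F_normal F_subset, of n' B'] CA A by blast
  then obtain n1 where n1: "C \<subseteq> up F n1 B"
    using up_mono [OF k, of n' F] up_add [of n' k F B] by blast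
  have commA: "comm x f \<in> A" if "x \<in> A" "f \<in> F" for x f
  proof -
    have "x \<otimes> (f \<otimes> inv x \<otimes> inv f) \<in> A" using that Ainv by blast
    then show ?thesis using that F_sub by (simp add: comm_def m_assoc)
  qed
  \<comment> \<open>The maps \<open>x \<mapsto> [x, z]\<close>, \<open>z \<in> S\<close>, embed \<open>A/C\<close> equivariantly into a power of \<open>A/B\<close>.\<close>
  have lift: "x \<in> up F n C" if "x \<in> A" "\<And>z. z \<in> S \<Longrightarrow> comm x z \<in> up F n B" for n x
    using that
  proof (induction n arbitrary: x)
    case 0
    then show ?case by (auto simp: C_def cent_def)
  next
    case (Suc n)
    have "comm x f \<in> up F n C" if f: "f \<in> F" for f
    proof (rule Suc.IH)
      show "comm x f \<in> A" using commA Suc.prems f by blast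
      fix z assume z: "z \<in> S"
      have c: "x \<in> carrier G" "f \<in> carrier G" "z \<in> carrier G" using Suc.prems f z F_sub SG by auto
      have "comm (comm x z) f \<in> up F n B"
        using Suc.prems(2) [OF z] f centD [of "comm x z" F "up F n B" f] by simp
      moreover have "B #> comm (comm x z) f = B #> comm (comm x f) z"
        using comm_swap [of x f z] Suc.prems(1) f z S c by (intro h_eq) auto
      ultimately show "comm (comm x f) z \<in> up F n B"
        using normal_cong [OF B(2) up_normal [OF B(2) F_normal] up_increasing [OF B(2) F_normal],
            of "comm (comm x z) f" "comm (comm x f) z" n] c by simp
    qed
    then show ?case using Suc.prems(1) by (auto intro!: centI)
  qed
  \<comment> \<open>If the commutators of \<open>x\<close> with \<open>S\<close> are already under
    control, \<open>lift\<close> brings \<open>x\<close> down to \<open>C\<close> in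
    \<open>n\<close> steps, and \<open>n1\<close> more steps bring \<open>C\<close> down to
    \<open>B\<close>.\<close>
  have step: "\<exists>n. A \<inter> up S j B \<subseteq> up F n B" for j
  proof (induction j)
    case 0
    show ?case by (intro exI [of _ 0]) simp
  next
    case (Suc j)
    then obtain n where n: "A \<inter> up S j B \<subseteq> up F n B" by blast
    have "A \<inter> up S (Suc j) B \<subseteq> up F (n + n1) B"
    proof
      fix x assume x: "x \<in> A \<inter> up S (Suc j) B"
      have "comm x z \<in> up F n B" if z: "z \<in> S" for z
        using n commA [of x z] x z SF centD [of x S "up S j B" z] by auto
      then have "x \<in> up F n C" using lift x by blast
      then show "x \<in> up F (n + n1) B" using up_mono [OF n1, of n F] by (auto simp: up_add)
    qed
    then show ?case by blast
  qed
  \<comment> \<open>The finite set \<open>S\<close> lies in a normal subgroup acting nilpotently on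
    \<open>G\<close>, so a fixed number \<open>s\<close> of commutators with \<open>S\<close>
    exhausts \<open>A\<close>.\<close>
  obtain N s where N: "S \<subseteq> N" "carrier G \<subseteq> up N s {\<one>}" using F_local [OF S(2) SF] by blast
  have "carrier G \<subseteq> up S s B"
    using N up_mono [of "{\<one>}" B s N] normal_one [OF B(2)] up_antimono [OF N(1), of s B] by blast
  then have "A \<subseteq> A \<inter> up S s B" using A.subset by blast
  then show ?case using step [of s] by blast
qed

text \<open>The chain condition reduces \<open>F\<close> to a finite \<open>S\<close>, hence to a
  nilpotent \<open>N\<close>, which has an element \<open>y\<close> of \<open>M\<close> outside
  \<open>P\<close> central for it. Almost centralization is then passed from \<open>N\<close> to
  \<open>F\<close> by symmetry, and \<open>exists_central_step\<close> turns nilpotent action on the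
  almost centralizer into an honest central element.\<close>

lemma exists_central_modulo:
  assumes P: "dfn P" "P \<lhd> G" and M: "M \<lhd> G" "M \<subseteq> F" and "\<not> M \<subseteq> P"
  shows "\<exists>x\<in>M - P. x \<in> cent F P"
proof -
  obtain d S where S: "S \<subseteq> F" "finite S" "\<And>f. f \<in> F \<Longrightarrow> index_le (cent S P) (cent {f} P) d"
    using chain [OF P] F_subset by metis
  obtain N s where N: "N \<lhd> G" "S \<subseteq> N" "carrier G \<subseteq> up N s {\<one>}" using F_local [OF S(2,1)] by blast
  have "M \<subseteq> up N s P"
    using N up_mono [of "{\<one>}" P s N] normal_one [OF P(2)] normal_subset [OF M(1)] by blast
  then have "\<not> M \<inter> up N s P \<subseteq> P" using assms by blast
  then obtain y where y: "y \<in> M - P" "y \<in> cent N P"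
    using exists_central_step [OF M(1) normal_subset [OF N(1)]] by blast
  \<comment> \<open>\<open>A\<close> centralizes \<open>S\<close> modulo \<open>P\<close>, so every
    \<open>f\<close> in \<open>F\<close> centralizes in it a subgroup of index at most
    \<open>d\<close>, as the symmetry lemma requires.\<close>
  define A where "A = M \<inter> cent N P"
  have A: "A \<lhd> G" unfolding A_def by (intro normal_subgroup_intersect cent_normal M N P)
  have idx: "index_le A (cent {f} P) d" if "f \<in> F" for f
    using S(3) [OF that] cent_antimono [OF N(2), of P] index_le_mono unfolding A_def by blast
  have A1: "index_le A (A \<inter> acent F P) d"
  proof (rule almost_centralizer_symmetry [OF P(2) _ _ idx])
    show "subgroup A G" "subgroup F G" "subgroup (A \<inter> acent F P) G"
      using A F_normal normal_subgroup_intersect [OF A acent_normal [OF P(2) F_normal]]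
      by (auto intro: normal_imp_subgroup)
    show "a \<in> A \<inter> acent F P" if "a \<in> A" "\<exists>n. index_le F (cent {a} P) n" for a
      using that normal_sub [OF A] by (auto simp: acent_def)
  qed
  \<comment> \<open>Otherwise \<open>A\<close> would be finite modulo \<open>P\<close>, so
    \<open>y\<close> would have a finite \<open>F\<close>-orbit and lie in \<open>acent F P\<close>,
    hence in \<open>P\<close>.\<close>
  have "\<not> A \<inter> acent F P \<subseteq> P"
  proof
    assume sub: "A \<inter> acent F P \<subseteq> P"
    have yA: "y \<in> A" using y by (simp add: A_def)
    have yc: "y \<in> carrier G" using yA normal_sub [OF A] by blast
    have "(\<lambda>f. P #> (f \<otimes> y \<otimes> inv f)) ` F \<subseteq> (\<lambda>a. P #> a) ` A"
      using normal_conj [OF A yA] F_sub by blast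
    moreover have "finite ((\<lambda>a. P #> a) ` A)"
    proof (rule index_le_image [OF A1])
      fix a b assume "a \<in> A" "b \<in> A" "inv a \<otimes> b \<in> A \<inter> acent F P"
      then show "P #> a = P #> b" using sub quotient_eq_iff [OF P(2)] normal_sub [OF A] by blast
    qed
    ultimately have "finite ((\<lambda>f. P #> (f \<otimes> y \<otimes> inv f)) ` F)" using finite_subset by blast
    then have "y \<in> acent F P"
      using index_le_orbit [OF P(2) yc F_subset] yc by (simp add: acent_def)
    then show False using sub yA y by blast
  qed
  moreover obtain k where "F \<inter> acent F P \<subseteq> up F k P" using F_Int_acent_subset_up [OF P] by blast
  ultimately have "\<not> M \<inter> up F k P \<subseteq> P" using M(2) unfolding A_def by blast
  then show ?thesis by (rule exists_central_step [OF M(1) F_subset])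
qed

text \<open>Kaluzhnin's argument for a stabilizer of a series: if \<open>x\<close> lowers the terms
  \<open>U i\<close> by \<open>j\<close> levels, then \<open>[x, f]\<close> lowers them by
  \<open>j + 1\<close>, because \<open>f\<close> itself lowers them by one.\<close>

lemma centralizer_of_up_coclass:
  defines "U \<equiv> \<lambda>i. F \<inter> up F i {\<one>}"
  shows "F \<subseteq> up F r (F \<inter> cent (U r) {\<one>})"
proof -
  \<comment> \<open>Subtraction is truncated and \<open>U 0\<close> is trivial, so
    \<open>L r\<close> centralizes \<open>U r\<close>; at the other end \<open>L 0\<close> is
    \<open>F\<close>.\<close>
  define L where "L j = {x \<in> F. \<forall>i\<le>r. \<forall>u\<in>U i. comm x u \<in> U (i - j)}" for j
  have U: "U i \<lhd> G" for i
    unfolding U_def by (intro normal_subgroup_intersect up_normal F_normal one_is_normal)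
  have UF: "U i \<subseteq> F" for i by (simp add: U_def)
  have Uc: "u \<in> carrier G" if "u \<in> U i" for u i using that U normal_sub by blast
  have Ustep: "comm u f \<in> U (i - 1)" if "u \<in> U i" "f \<in> F" for u f i
  proof (cases i)
    case 0
    then have "u = \<one>" using that by (simp add: U_def)
    then have "comm u f = \<one>" using that F_sub by (simp add: comm_def)
    then show ?thesis using U normal_one by simp
  next
    case (Suc i')
    then show ?thesis
      using that comm_in_normal_left [OF F_normal, of u f] F_sub centD [of u F "up F i' {\<one>}" f]
      by (auto simp: U_def)
  qed
  have "L j \<subseteq> cent F (L (Suc j))" for j
  proof (intro subsetI centI)
    fix x assume "x \<in> L j"
    then show "x \<in> carrier G" using F_sub by (simp add: L_def)
  next
    fix x f assume x: "x \<in> L j" and f: "f \<in> F"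
    have xF: "x \<in> F" using x by (simp add: L_def)
    have c: "x \<in> carrier G" "f \<in> carrier G" using xF f F_sub by auto
    have "comm (comm x f) u \<in> U (i - Suc j)" if i: "i \<le> r" and u: "u \<in> U i" for i u
    proof -
      define V where "V = U (i - Suc j)"
      have V: "V \<lhd> G" using U by (simp add: V_def)
      obtain H :: "'a set monoid" and h where h: "group_hom G H h"
        and hV: "\<And>x. x \<in> carrier G \<Longrightarrow> x \<in> V \<longleftrightarrow> h x = \<one>\<^bsub>H\<^esub>"
        using quotientE [OF V] by blast
      interpret h: group_hom G H h by (rule h)
      have h_comm_iff: "comm x y \<in> V \<longleftrightarrow> h x \<otimes>\<^bsub>H\<^esub> h y = h y \<otimes>\<^bsub>H\<^esub> h x"
        if "x \<in> carrier G" "y \<in> carrier G" for x y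
        using that hV [of "comm x y"] h.hom_comm h.H.comm_eq_one_iff [of "h x" "h y"] by simp
      have uc: "u \<in> carrier G" using u Uc by blast
      have Lx: "comm (inv x) v \<in> U (i - j)" if "i \<le> r" "v \<in> U i" for i v
      proof -
        have vc: "v \<in> carrier G" using that Uc by blast
        have "comm x v \<in> U (i - j)" using x that by (simp add: L_def)
        then have "inv x \<otimes> inv (comm x v) \<otimes> x \<in> U (i - j)"
          using c normal_conj' [OF U] normal_inv [OF U] by blast
        then show ?thesis using c vc by (simp add: comm_def word_simps)
      qed
      \<comment> \<open>Inverses are used because \<open>comm_inverse_centralizes\<close> controls
        the commutator of the inverses of its arguments, here \<open>[x, f]\<close>.\<close>
      define a b where "a = comm (inv x) u" and "b = comm (inv f) u"
      have invf: "inv f \<in> F" using f normal_inv [OF F_normal] by blast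
      have a: "a \<in> U (i - j)" using Lx i u by (simp add: a_def)
      have b: "b \<in> U (i - 1)"
        using Ustep [OF u invf] comm_sym [OF U uc] c by (simp add: b_def)
      have ac: "a \<in> carrier G" "b \<in> carrier G" using a b Uc by auto
      have bF: "b \<in> F" using b UF by blast
      have "comm a (inv f) \<in> V" using Ustep [OF a invf] by (simp add: V_def)
      then have 1: "h a \<otimes>\<^bsub>H\<^esub> h (inv f) = h (inv f) \<otimes>\<^bsub>H\<^esub> h a" using h_comm_iff ac c by blast
      have "comm a b \<in> V" using Ustep [OF a bF] by (simp add: V_def)
      then have 2: "h a \<otimes>\<^bsub>H\<^esub> h b = h b \<otimes>\<^bsub>H\<^esub> h a" using h_comm_iff ac by blast
      have "comm (inv x) b \<in> U (i - 1 - j)" using Lx [of "i - 1" b] b i by simp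
      then have "comm (inv x) b \<in> V" by (simp add: V_def)
      then have 3: "h (inv x) \<otimes>\<^bsub>H\<^esub> h b = h b \<otimes>\<^bsub>H\<^esub> h (inv x)" using h_comm_iff ac c by blast
      have hu: "h (inv x) \<otimes>\<^bsub>H\<^esub> h u = h a \<otimes>\<^bsub>H\<^esub> h u \<otimes>\<^bsub>H\<^esub> h (inv x)"
        "h (inv f) \<otimes>\<^bsub>H\<^esub> h u = h b \<otimes>\<^bsub>H\<^esub> h u \<otimes>\<^bsub>H\<^esub> h (inv f)"
      proof -
        have "inv x \<otimes> u = a \<otimes> u \<otimes> inv x" "inv f \<otimes> u = b \<otimes> u \<otimes> inv f"
          using c uc by (simp_all add: a_def b_def comm_def word_simps)
        then show "h (inv x) \<otimes>\<^bsub>H\<^esub> h u = h a \<otimes>\<^bsub>H\<^esub> h u \<otimes>\<^bsub>H\<^esub> h (inv x)"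
          "h (inv f) \<otimes>\<^bsub>H\<^esub> h u = h b \<otimes>\<^bsub>H\<^esub> h u \<otimes>\<^bsub>H\<^esub> h (inv f)"
          using c uc ac by (metis h.hom_mult m_closed inv_closed)+
      qed
      have "h.H.comm (h x) (h f) \<otimes>\<^bsub>H\<^esub> h u = h u \<otimes>\<^bsub>H\<^esub> h.H.comm (h x) (h f)"
        using h.H.comm_inverse_centralizes [OF _ _ _ _ _ hu 1 3 2] c uc ac
        by (simp add: h.H.comm_def)
      then show ?thesis
        using h_comm_iff [of "comm x f" u] c uc by (simp add: h.hom_comm V_def)
    qed
    moreover have "comm x f \<in> F" using xF c comm_in_normal_left [OF F_normal] by blast
    ultimately show "comm x f \<in> L (Suc j)" by (simp add: L_def)
  qed
  then have "L 0 \<subseteq> up F j (L j)" for j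
  proof (induction j)
    case (Suc j)
    then show ?case using up_mono [of "L j" "cent F (L (Suc j))" j F] up_add [of j 1 F "L (Suc j)"] by auto
  qed simp
  then have "L 0 \<subseteq> up F r (L r)" .
  moreover have "F \<subseteq> L 0"
    using comm_in_normal_right [OF U] F_sub by (auto simp: L_def)
  moreover have "L r \<subseteq> F \<inter> cent (U r) {\<one>}"
    using F_sub by (auto simp: L_def cent_def U_def)
  ultimately show ?thesis using up_mono by blast
qed

theorem F_hypercentral: "\<exists>n. F \<subseteq> up F n {\<one>}"
proof -
  let ?U = "\<lambda>i. F \<inter> up F i {\<one>}"
  have one: "dfn {\<one>}" "{\<one>} \<lhd> G" by (intro dfn_one one_is_normal)+
  define Y where "Y = (\<Union>i. ?U i)"
  have "Y \<subseteq> carrier G" using F_subset by (auto simp: Y_def)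
  then obtain d S where S: "S \<subseteq> Y" "finite S"
    "\<And>y. y \<in> Y \<Longrightarrow> index_le (cent S {\<one>}) (cent {y} {\<one>}) d"
    using chain [OF one] by metis
  have "\<exists>r. S \<subseteq> ?U r"
    using S(2,1)
  proof (induction S)
    case (insert s S)
    then obtain r i where "S \<subseteq> ?U r" "s \<in> ?U i" by (auto simp: Y_def)
    then have "insert s S \<subseteq> ?U (max r i)"
      using up_le [OF one(2) F_normal, of r "max r i"] up_le [OF one(2) F_normal, of i "max r i"]
      by auto
    then show ?case by blast
  qed simp
  then obtain r where r: "S \<subseteq> ?U r" by blast
  define M where "M = F \<inter> cent (?U r) {\<one>}"
  have M: "M \<lhd> G"
    unfolding M_def by (intro normal_subgroup_intersect cent_normal up_normal F_normal one)
  have MF: "M \<subseteq> F" by (simp add: M_def)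
  have FM: "F \<subseteq> up F r M" unfolding M_def by (rule centralizer_of_up_coclass)
  define P where "P = acent M {\<one>}"
  have P: "dfn P" "P \<lhd> G"
    unfolding P_def by (intro acent_definable acent_normal one M)+
  have YP: "Y \<subseteq> P"
  proof
    fix y assume y: "y \<in> Y"
    have "M \<subseteq> cent S {\<one>}" using cent_antimono [OF r, of "{\<one>}"] by (auto simp: M_def)
    then have "index_le M (cent {y} {\<one>}) d" using S(3) [OF y] index_le_mono by blast
    then show "y \<in> P" using y \<open>Y \<subseteq> carrier G\<close> by (auto simp: P_def acent_def)
  qed
  define Q where "Q = M \<inter> P"
  have Q: "Q \<lhd> G" unfolding Q_def by (intro normal_subgroup_intersect M P)
  have QF: "Q \<subseteq> F" using MF by (auto simp: Q_def)
  obtain M1 e k where M1: "M1 \<lhd> G" "M1 \<subseteq> M" "Q \<subseteq> M1" "index_le M M1 e"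
    "Q \<subseteq> cent M1 (up F k {\<one>})"
    using acent_Int_commutators [OF one M MF] unfolding Q_def P_def by blast
  \<comment> \<open>\<open>Q\<close> centralizes \<open>M1\<close> only modulo
    \<open>up F k {\<one>}\<close>, which need not be definable; the hull \<open>B\<close> is an
    admissible denominator. As \<open>Q\<close> lies in \<open>M1\<close>, it is also abelian modulo
    \<open>B\<close>.\<close>
  obtain B k' where B: "dfn B" "B \<lhd> G" "F \<inter> up F k {\<one>} \<subseteq> B" "F \<inter> B \<subseteq> up F k' {\<one>}"
    using up_definable_hull [OF one, of k] by blast
  have M1F: "M1 \<subseteq> F" using M1(2) MF by blast
  have QM1: "Q \<subseteq> cent M1 B"
  proof (intro subsetI centI)
    fix x y assume "x \<in> Q" "y \<in> M1"
    then have "comm x y \<in> F \<inter> up F k {\<one>}"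
      using M1(5) centD comm_in_normal_left [OF F_normal] QF M1F F_sub by blast
    then show "comm x y \<in> B" using B(3) by blast
  qed (use QF F_sub in blast)
  \<comment> \<open>\<open>M\<close> is finite modulo \<open>M1\<close>, so nilpotency of
    \<open>F\<close> modulo \<open>M\<close> extends to nilpotency modulo \<open>M1\<close>.\<close>
  have "\<exists>c. M \<subseteq> up F c M1"
  proof (rule finite_invariant_subset_up [OF M1(1) normal_subset [OF M]])
    show "f \<otimes> s \<otimes> inv f \<in> M" if "f \<in> F" "s \<in> M" for f s
      using that F_sub normal_conj [OF M] by blast
    show "finite ((\<lambda>s. M1 #> s) ` M)"
      by (rule index_le_image [OF M1(4)]) (use quotient_eq_iff [OF M1(1)] normal_sub [OF M] in blast)
  qed
  then obtain c where "M \<subseteq> up F c M1" by blast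
  then have "F \<subseteq> up F (r + c) M1" using FM up_mono [of M "up F c M1" r F] by (auto simp: up_add)
  moreover have "Q \<subseteq> cent Q B" using QM1 cent_antimono [OF M1(3)] by blast
  moreover have "f \<otimes> a \<otimes> inv f \<in> Q" if "f \<in> F" "a \<in> Q" for f a
    using that F_sub normal_conj [OF Q] by blast
  ultimately obtain n where "Q \<subseteq> up F n B"
    using abelian_nilpotent_action [OF M1(1) M1F _ B(1,2) normal_imp_subgroup [OF Q] QF _ _ QM1]
    by blast
  then have "Q \<subseteq> up F n (F \<inter> B)" using up_Int [OF F_normal F_subset, of n B] QF by blast
  then have Qup: "Q \<subseteq> up F (n + k') {\<one>}" using up_mono [OF B(4), of n F] by (auto simp: up_add)
  have "M \<subseteq> P"
  proof (rule ccontr)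
    assume "\<not> M \<subseteq> P"
    then obtain x where x: "x \<in> M" "x \<notin> P" "x \<in> cent F P"
      using exists_central_modulo [OF P M MF] by blast
    have "comm x f \<in> up F (n + k') {\<one>}" if f: "f \<in> F" for f
    proof -
      have "comm x f \<in> Q"
        using x f centD comm_in_normal_left [OF M] F_sub by (auto simp: Q_def)
      then show ?thesis using Qup by blast
    qed
    then have "x \<in> ?U (Suc (n + k'))"
      using x MF F_sub by (auto intro!: centI)
    then have "x \<in> Y" unfolding Y_def by blast
    then show False using YP x by blast
  qed
  then have "M \<subseteq> up F (n + k') {\<one>}" using Qup by (auto simp: Q_def)
  then have "F \<subseteq> up F (r + (n + k')) {\<one>}"
    using FM up_mono [of M "up F (n + k') {\<one>}" r F] by (auto simp: up_add)
  then show ?thesis by blast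
qed

end

section \<open>The Fitting subgroup\<close>

context group
begin

lemma lower_central_subset_up:
  assumes N: "N \<lhd> G" and "N \<subseteq> up N n {\<one>}" and "i \<le> n"
  shows "lower_central (G\<lparr>carrier := N\<rparr>) i \<subseteq> N \<inter> up N (n - i) {\<one>}"
  using assms(3)
proof (induction i)
  case 0
  then show ?case using assms by simp
next
  case (Suc i)
  have sub: "subgroup N G" using N by (rule normal_imp_subgroup)
  let ?V = "N \<inter> up N (n - Suc i) {\<one>}"
  have V: "subgroup ?V G"
    by (intro normal_imp_subgroup normal_subgroup_intersect up_normal one_is_normal N)
  let ?K = "\<Union>x\<in>lower_central (G\<lparr>carrier := N\<rparr>) i. \<Union>y\<in>N.
    {x \<otimes> y \<otimes> inv\<^bsub>G\<lparr>carrier := N\<rparr>\<^esub> x \<otimes> inv\<^bsub>G\<lparr>carrier := N\<rparr>\<^esub> y}"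
  have K: "?K \<subseteq> ?V"
  proof clarify
    fix x y assume x: "x \<in> lower_central (G\<lparr>carrier := N\<rparr>) i" and y: "y \<in> N"
    have x': "x \<in> N" "x \<in> up N (Suc (n - Suc i)) {\<one>}"
      using Suc x by (auto simp: Suc_diff_Suc simp del: funpow.simps)
    have "x \<otimes> y \<otimes> inv\<^bsub>G\<lparr>carrier := N\<rparr>\<^esub> x \<otimes> inv\<^bsub>G\<lparr>carrier := N\<rparr>\<^esub> y = comm x y"
      using x' y sub by (simp add: comm_def)
    moreover have "comm x y \<in> up N (n - Suc i) {\<one>}" using x'(2) y centD by simp
    moreover have "comm x y \<in> N" using comm_in_normal_left [OF N x'(1)] normal_sub [OF N y] by blast
    ultimately show "x \<otimes> y \<otimes> inv\<^bsub>G\<lparr>carrier := N\<rparr>\<^esub> x \<otimes> inv\<^bsub>G\<lparr>carrier := N\<rparr>\<^esub> y \<in> ?V" by simp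
  qed
  have "lower_central (G\<lparr>carrier := N\<rparr>) (Suc i) = generate G ?K"
    using generate_consistent [OF _ sub, of ?K] K by simp
  also have "\<dots> \<subseteq> ?V" by (rule generate_subgroup_incl [OF K V])
  finally show ?case .
qed

lemma nilpotent_of_up:
  assumes N: "N \<lhd> G" and "N \<subseteq> up N n {\<one>}"
  shows "nilpotent_group (G\<lparr>carrier := N\<rparr>)"
proof -
  have "lower_central (G\<lparr>carrier := N\<rparr>) n \<subseteq> {\<one>}"
    using lower_central_subset_up [OF assms order_refl] by auto
  moreover have "\<one> \<in> lower_central (G\<lparr>carrier := N\<rparr>) n"
  proof (cases n)
    case (Suc m)
    have "\<one>\<^bsub>G\<lparr>carrier := N\<rparr>\<^esub> \<in> lower_central (G\<lparr>carrier := N\<rparr>) n"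
      unfolding Suc lower_central.simps by (rule generate.one)
    then show ?thesis by simp
  qed (use N normal_one in simp)
  ultimately have "lower_central (G\<lparr>carrier := N\<rparr>) n = {\<one>\<^bsub>G\<lparr>carrier := N\<rparr>\<^esub>}" by auto
  then show ?thesis
    unfolding nilpotent_group_def using subgroup_imp_group [OF normal_imp_subgroup [OF N]] by blast
qed

text \<open>Recording the action of \<open>N\<close> on all of \<open>G\<close>, not only on itself,
  lets the bound apply to every subset of \<open>G\<close> and modulo every normal subgroup.\<close>

lemma nilpotent_normal_up:
  assumes N: "N \<lhd> G" and "nilpotent_group (G\<lparr>carrier := N\<rparr>)"
  shows "\<exists>c. carrier G \<subseteq> up N c {\<one>}"
proof -
  have sub: "subgroup N G" using N by (rule normal_imp_subgroup)
  let ?L = "lower_central (G\<lparr>carrier := N\<rparr>)"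
  obtain n where n: "?L n = {\<one>}" using assms(2) by (auto simp: nilpotent_group_def)
  have L: "?L i \<subseteq> N" for i
  proof (induction i)
    case (Suc i)
    interpret N: group "G\<lparr>carrier := N\<rparr>" using subgroup_imp_group [OF sub] .
    have "?L (Suc i) \<subseteq> carrier (G\<lparr>carrier := N\<rparr>)"
      unfolding lower_central.simps
      by (rule N.generate_incl) (use Suc N.m_closed N.inv_closed in \<open>auto 0 3\<close>)
    then show ?case by simp
  qed simp
  have "?L (n - j) \<subseteq> up N j {\<one>}" if "j \<le> n" for j
    using that
  proof (induction j)
    case 0
    then show ?case using n by simp
  next
    case (Suc j)
    show ?case
    proof
      fix x assume x: "x \<in> ?L (n - Suc j)"
      have "comm x y \<in> up N j {\<one>}" if y: "y \<in> N" for y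
      proof -
        have "x \<otimes> y \<otimes> inv\<^bsub>G\<lparr>carrier := N\<rparr>\<^esub> x \<otimes> inv\<^bsub>G\<lparr>carrier := N\<rparr>\<^esub> y \<in> ?L (Suc (n - Suc j))"
          unfolding lower_central.simps by (rule generate.incl) (use x y in auto)
        moreover have "Suc (n - Suc j) = n - j" using Suc.prems by simp
        moreover have "x \<otimes> y \<otimes> inv\<^bsub>G\<lparr>carrier := N\<rparr>\<^esub> x \<otimes> inv\<^bsub>G\<lparr>carrier := N\<rparr>\<^esub> y = comm x y"
          using subsetD [OF L x] y sub by (simp add: comm_def)
        ultimately show ?thesis using Suc by auto
      qed
      then show "x \<in> up N (Suc j) {\<one>}" using x L normal_sub [OF N] by (auto intro!: centI)
    qed
  qed
  from this [of n] have "N \<subseteq> up N n {\<one>}" by simp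
  \<comment> \<open>The extra factor carries \<open>G\<close> into \<open>N\<close>.\<close>
  then have "carrier G \<subseteq> up N (Suc n) {\<one>}"
    using comm_in_normal_right [OF N] by (auto intro!: centI)
  then show ?thesis by blast
qed

text \<open>Fitting's theorem in terms of the action on \<open>G\<close>: a commutator with
  \<open>N1\<close> lowers \<open>i\<close> and keeps \<open>j\<close>, since the iterated
  centralizers of \<open>N2\<close> are normal; with \<open>N2\<close> the roles are
  exchanged.\<close>

lemma up_join:
  assumes N: "N1 \<lhd> G" "N2 \<lhd> G"
  defines "N \<equiv> generate G (N1 \<union> N2)"
  shows "up N1 i {\<one>} \<inter> up N2 j {\<one>} \<subseteq> up N (i + j) {\<one>}"
proof (induction "i + j" arbitrary: i j)
  case (Suc m)
  have one: "{\<one>} \<lhd> G" by (rule one_is_normal)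
  have Ncar: "N1 \<union> N2 \<subseteq> carrier G" using N normal_subset by auto
  have NN: "N \<lhd> G"
    unfolding N_def using N normal_conj by (intro normal_generateI Ncar) blast
  have V: "up N m {\<one>} \<lhd> G" by (rule up_normal [OF one NN])
  show ?case
  proof
    fix x assume x: "x \<in> up N1 i {\<one>} \<inter> up N2 j {\<one>}"
    then have xc: "x \<in> carrier G" using normal_sub [OF up_normal [OF one N(1)]] by blast
    have "comm x y \<in> up N m {\<one>}" if y: "y \<in> N1" for y
    proof (cases i)
      case 0
      then have "comm x y = \<one>" using x y normal_sub [OF N(1)] by (auto simp: comm_def)
      then show ?thesis using normal_one [OF V] by simp
    next
      case (Suc i')
      have "comm x y \<in> up N1 i' {\<one>}"
        using x y Suc centD [of x N1 "up N1 i' {\<one>}" y] by simp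
      moreover have "comm x y \<in> up N2 j {\<one>}"
        using x y comm_in_normal_left [OF up_normal [OF one N(2)]] normal_sub [OF N(1)] by blast
      ultimately show ?thesis using Suc.hyps(1) [of i' j] Suc.hyps(2) Suc by auto
    qed
    moreover have "comm x y \<in> up N m {\<one>}" if y: "y \<in> N2" for y
    proof (cases j)
      case 0
      then have "comm x y = \<one>" using x y normal_sub [OF N(2)] by (auto simp: comm_def)
      then show ?thesis using normal_one [OF V] by simp
    next
      case (Suc j')
      have "comm x y \<in> up N2 j' {\<one>}"
        using x y Suc centD [of x N2 "up N2 j' {\<one>}" y] by simp
      moreover have "comm x y \<in> up N1 i {\<one>}"
        using x y comm_in_normal_left [OF up_normal [OF one N(1)]] normal_sub [OF N(2)] by blast
      ultimately show ?thesis using Suc.hyps(1) [of i j'] Suc.hyps(2) Suc by auto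
    qed
    \<comment> \<open>For fixed \<open>x\<close>, the elements whose commutator with
      \<open>x\<close> lies in a normal subgroup form a subgroup, so generators of \<open>N\<close>
      suffice.\<close>
    ultimately have "N1 \<union> N2 \<subseteq> cent {x} (up N m {\<one>})"
      using comm_sym [OF V xc] Ncar by (auto simp: subset_iff intro!: centI)
    then have "N \<subseteq> cent {x} (up N m {\<one>})"
      unfolding N_def using cent_subgroup [OF V] xc by (intro generate_subgroup_incl) (auto simp: N_def)
    then have "comm x y \<in> up N m {\<one>}" if "y \<in> N" for y
      using that centD comm_sym [OF V xc] normal_sub [OF NN] by blast
    then have "x \<in> up N (Suc m) {\<one>}" using xc by (auto intro!: centI)
    then show "x \<in> up N (i + j) {\<one>}" using Suc.hyps(2) by simp
  qed
qed simp

lemma fitting_subgroup_normal: "fitting_subgroup G \<lhd> G"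
  unfolding fitting_subgroup_def
  by (rule normal_generateI) (use normal_sub normal_conj in blast)+

text \<open>The normal subgroups acting nilpotently on \<open>G\<close> are directed by
  \<open>up_join\<close>, so each word in the generators, and then each finite set, is caught by one
  of them.\<close>

lemma fitting_subgroup_local:
  assumes "finite S" "S \<subseteq> fitting_subgroup G"
  shows "\<exists>N c. N \<lhd> G \<and> S \<subseteq> N \<and> carrier G \<subseteq> up N c {\<one>}"
proof -
  define good where "good N \<longleftrightarrow> N \<lhd> G \<and> (\<exists>c. carrier G \<subseteq> up N c {\<one>})" for N
  have join: "\<exists>N. good N \<and> N1 \<union> N2 \<subseteq> N" if good: "good N1" "good N2" for N1 N2
  proof -
    have N: "N1 \<lhd> G" "N2 \<lhd> G" using good by (auto simp: good_def)
    obtain c1 c2 where "carrier G \<subseteq> up N1 c1 {\<one>}" "carrier G \<subseteq> up N2 c2 {\<one>}"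
      using good by (auto simp: good_def)
    then have "carrier G \<subseteq> up (generate G (N1 \<union> N2)) (c1 + c2) {\<one>}"
      using up_join [OF N, of c1 c2] by blast
    moreover have "generate G (N1 \<union> N2) \<lhd> G"
      using N normal_conj normal_subset by (intro normal_generateI) blast+
    ultimately have "good (generate G (N1 \<union> N2))" by (auto simp: good_def)
    then show ?thesis using generate.incl [of _ "N1 \<union> N2" G] by blast
  qed
  have one: "good {\<one>}"
    using one_is_normal comm_in_normal_right [OF one_is_normal, of \<one>]
    by (auto simp: good_def intro!: exI [of _ 1] centI)
  have el: "\<exists>N. good N \<and> x \<in> N" if "x \<in> fitting_subgroup G" for x
    using that unfolding fitting_subgroup_def
  proof (induction rule: generate.induct)
    case one
    then show ?case using \<open>good {\<one>}\<close> by blast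
  next
    case (incl h)
    then show ?case using nilpotent_normal_up by (auto simp: good_def)
  next
    case (inv h)
    then show ?case using nilpotent_normal_up normal_inv by (auto simp: good_def)
  next
    case (eng h1 h2)
    then obtain N1 N2 where "good N1" "good N2" "h1 \<in> N1" "h2 \<in> N2" by blast
    then obtain N where "good N" "h1 \<in> N" "h2 \<in> N" using join [of N1 N2] by blast
    then show ?case using normal_mult by (auto simp: good_def)
  qed
  have "\<exists>N. good N \<and> S \<subseteq> N"
    using assms
  proof (induction S)
    case empty
    then show ?case using one by blast
  next
    case (insert x S)
    then obtain N1 N2 where "good N1" "x \<in> N1" "good N2" "S \<subseteq> N2" using el by blast
    then show ?case using join [of N1 N2] by blast
  qed
  then show ?thesis by (auto simp: good_def)
qed

end

section \<open>Definability of almost centralizers\<close>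

fun rename_term :: "(nat \<Rightarrow> nat) \<Rightarrow> 'f fo_term \<Rightarrow> 'f fo_term" where
  "rename_term g (Var i) = Var (g i)"
| "rename_term g One = One"
| "rename_term g (Inverse t) = Inverse (rename_term g t)"
| "rename_term g (Times s t) = Times (rename_term g s) (rename_term g t)"
| "rename_term g (Fun f ts) = Fun f (map (rename_term g) ts)"

fun rename_formula :: "(nat \<Rightarrow> nat) \<Rightarrow> ('f, 'r) fo_formula \<Rightarrow> ('f, 'r) fo_formula" where
  "rename_formula g (Equal s t) = Equal (rename_term g s) (rename_term g t)"
| "rename_formula g (Rel r ts) = Rel r (map (rename_term g) ts)"
| "rename_formula g (Neg p) = Neg (rename_formula g p)"
| "rename_formula g (Conj p q) = Conj (rename_formula g p) (rename_formula g q)"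
| "rename_formula g (Exists i p) = Exists (g i) (rename_formula g p)"

lemma wf_rename_term [simp]: "wf_term G (rename_term g t) = wf_term G t"
  by (induction t) auto

lemma wf_rename_formula [simp]: "wf_formula G (rename_formula g p) = wf_formula G p"
  by (induction p) auto

lemma eval_rename_term [simp]: "eval_term G e (rename_term g t) = eval_term G (e \<circ> g) t"
proof (induction t)
  case (Fun f ts)
  then have "map (\<lambda>t. eval_term G e (rename_term g t)) ts = map (eval_term G (e \<circ> g)) ts"
    by (simp add: comp_def)
  then show ?case by (simp only: rename_term.simps eval_term.simps map_map comp_def)
qed auto

text \<open>Bound variables are renamed as well; injectivity of \<open>g\<close> prevents
  capture.\<close>

lemma sat_rename_formula: "inj g \<Longrightarrow> sat G e (rename_formula g p) = sat G (e \<circ> g) p"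
proof (induction p arbitrary: e)
  case (Rel r ts)
  show ?case by (simp add: comp_def)
next
  case (Exists i p)
  have "(e(g i := a)) \<circ> g = (e \<circ> g)(i := a)" for a
    using Exists.prems by (auto simp: fun_eq_iff inj_eq)
  then have "sat G (e(g i := a)) (rename_formula g p) = sat G ((e \<circ> g)(i := a)) p" for a
    using Exists.IH [OF Exists.prems, of "e(g i := a)"] by (simp only:)
  then show ?case by (simp only: rename_formula.simps sat.simps)
qed auto

text \<open>
  Even variables carry the arguments, odd ones the parameters, so that formulas with different
  parameters can be combined after renaming.
\<close>

definition interleave :: "(nat \<Rightarrow> 'a) \<Rightarrow> (nat \<Rightarrow> 'a) \<Rightarrow> nat \<Rightarrow> 'a" where
  "interleave v e i = (if even i then v (i div 2) else e (i div 2))"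

lemma interleave_simps [simp]:
  "interleave v e (2 * i) = v i" "interleave v e (Suc (2 * i)) = e i"
  by (simp_all add: interleave_def)

lemma interleave_eqI:
  "(\<And>i. w (2 * i) = v i) \<Longrightarrow> (\<And>i. w (Suc (2 * i)) = e i) \<Longrightarrow> w = interleave v e"
proof
  fix i assume "\<And>i. w (2 * i) = v i" "\<And>i. w (Suc (2 * i)) = e i"
  then show "w i = interleave v e i"
    by (cases "even i") (auto elim!: evenE oddE)
qed

text \<open>Predicates on whole assignments allow quantification over any variable while parameters
  stay out of reach in the odd slots. Only assignments into the carrier are compared.\<close>

definition definable_pred ::
  "('a, 'f, 'r, 'z) expanded_group_scheme \<Rightarrow> ((nat \<Rightarrow> 'a) \<Rightarrow> bool) \<Rightarrow> bool" where
  "definable_pred G \<Phi> \<longleftrightarrow> (\<exists>p e. wf_formula G p \<and> range e \<subseteq> carrier G \<and>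
     (\<forall>v. range v \<subseteq> carrier G \<longrightarrow> \<Phi> v = sat G (interleave v e) p))"

context expanded_group
begin

lemma eval_term_closed: "wf_term G t \<Longrightarrow> range e \<subseteq> carrier G \<Longrightarrow> eval_term G e t \<in> carrier G"
proof (induction t)
  case (Fun f ts)
  then show ?case using fun_interp_closed [of f "map (eval_term G e) ts"] by auto
qed auto

lemma definable_pred_True: "definable_pred G (\<lambda>v. True)"
  unfolding definable_pred_def
  by (intro exI [of _ "Equal One One"] exI [of _ "\<lambda>_. \<one>"]) auto

lemma definable_pred_Neg:
  assumes "definable_pred G \<Phi>" shows "definable_pred G (\<lambda>v. \<not> \<Phi> v)"
proof -
  obtain p e where "wf_formula G p" "range e \<subseteq> carrier G"
    "\<And>v. range v \<subseteq> carrier G \<Longrightarrow> \<Phi> v = sat G (interleave v e) p"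
    using assms unfolding definable_pred_def by blast
  then show ?thesis
    unfolding definable_pred_def by (intro exI [of _ "Neg p"] exI [of _ e]) auto
qed

lemma definable_pred_Conj:
  assumes "definable_pred G \<Phi>" "definable_pred G \<Psi>"
  shows "definable_pred G (\<lambda>v. \<Phi> v \<and> \<Psi> v)"
proof -
  obtain p e where p: "wf_formula G p" "range e \<subseteq> carrier G"
    "\<And>v. range v \<subseteq> carrier G \<Longrightarrow> \<Phi> v = sat G (interleave v e) p"
    using assms(1) unfolding definable_pred_def by blast
  obtain q f where q: "wf_formula G q" "range f \<subseteq> carrier G"
    "\<And>v. range v \<subseteq> carrier G \<Longrightarrow> \<Psi> v = sat G (interleave v f) q"
    using assms(2) unfolding definable_pred_def by blast
  define g where "g b k = (if even k then k else 2 * k - 1 + b)" for b k :: nat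
  \<comment> \<open>The odd variable \<open>2 * i + 1\<close> goes to \<open>4 * i + 1\<close> under
    \<open>g 0\<close> and to \<open>4 * i + 3\<close> under \<open>g 2\<close>: the slots of
    \<open>e i\<close> and \<open>f i\<close> once the parameters are
    \<open>interleave e f\<close>.\<close>
  have inj: "inj (g 0)" "inj (g 2)"
    by (auto simp: inj_def g_def split: if_splits elim!: oddE; presburger)+
  have "interleave v (interleave e f) \<circ> g 0 = interleave v e" for v
  proof (rule interleave_eqI)
    fix i
    show "(interleave v (interleave e f) \<circ> g 0) (Suc (2 * i)) = e i"
      using interleave_simps(2) [of v "interleave e f" "2 * i"] by (simp add: g_def)
  qed (simp add: g_def)
  moreover have "interleave v (interleave e f) \<circ> g 2 = interleave v f" for v
  proof (rule interleave_eqI)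
    fix i
    show "(interleave v (interleave e f) \<circ> g 2) (Suc (2 * i)) = f i"
      using interleave_simps(2) [of v "interleave e f" "Suc (2 * i)"] by (simp add: g_def)
  qed (simp add: g_def)
  moreover have "range (interleave e f) \<subseteq> carrier G"
    using p(2) q(2) by (auto simp: interleave_def)
  ultimately show ?thesis
    unfolding definable_pred_def using p q inj
    by (intro exI [of _ "Conj (rename_formula (g 0) p) (rename_formula (g 2) q)"] exI [of _ "interleave e f"])
      (simp add: sat_rename_formula)
qed

lemma definable_pred_Ball:
  assumes "finite S" "\<And>s. s \<in> S \<Longrightarrow> definable_pred G (\<Phi> s)"
  shows "definable_pred G (\<lambda>v. \<forall>s\<in>S. \<Phi> s v)"
  using assms
proof (induction S)
  case empty
  then show ?case using definable_pred_True by simp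
next
  case (insert s S)
  then have "definable_pred G (\<lambda>v. \<Phi> s v \<and> (\<forall>s\<in>S. \<Phi> s v))" by (intro definable_pred_Conj) auto
  then show ?case by simp
qed

lemma definable_pred_Exists:
  assumes "definable_pred G \<Phi>"
  shows "definable_pred G (\<lambda>v. \<exists>a\<in>carrier G. \<Phi> (v(i := a)))"
proof -
  obtain p e where p: "wf_formula G p" "range e \<subseteq> carrier G"
    "\<And>v. range v \<subseteq> carrier G \<Longrightarrow> \<Phi> v = sat G (interleave v e) p"
    using assms(1) unfolding definable_pred_def by blast
  have "(interleave v e)(2 * i := a) = interleave (v(i := a)) e" for v a
    by (rule interleave_eqI) (auto simp: Suc_double_not_eq_double)
  moreover have "range (v(i := a)) \<subseteq> carrier G" if "range v \<subseteq> carrier G" "a \<in> carrier G" for v a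
    using that by auto
  ultimately show ?thesis
    unfolding definable_pred_def using p
    by (intro exI [of _ "Exists (2 * i) p"] exI [of _ e]) auto
qed

lemma definable_pred_Exists_finite:
  assumes "finite I" "definable_pred G \<Phi>"
  shows "definable_pred G (\<lambda>v. \<exists>u. range u \<subseteq> carrier G \<and> (\<forall>i. i \<notin> I \<longrightarrow> u i = v i) \<and> \<Phi> u)"
  using assms(1)
proof (induction I)
  case empty
  obtain p e where "wf_formula G p" "range e \<subseteq> carrier G"
    "\<And>v. range v \<subseteq> carrier G \<Longrightarrow> \<Phi> v = sat G (interleave v e) p"
    using assms(2) unfolding definable_pred_def by blast
  moreover have "(\<exists>u. range u \<subseteq> carrier G \<and> (\<forall>i. i \<notin> {} \<longrightarrow> u i = v i) \<and> \<Phi> u) = \<Phi> v"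
    if "range v \<subseteq> carrier G" for v
  proof -
    have "(\<forall>i. i \<notin> {} \<longrightarrow> u i = v i) \<longleftrightarrow> u = v" for u by auto
    then show ?thesis using that by simp
  qed
  ultimately show ?case
    unfolding definable_pred_def by (metis (no_types, lifting))
next
  case (insert k I)
  let ?\<Psi> = "\<lambda>v. \<exists>u. range u \<subseteq> carrier G \<and> (\<forall>i. i \<notin> I \<longrightarrow> u i = v i) \<and> \<Phi> u"
  have "definable_pred G (\<lambda>v. \<exists>a\<in>carrier G. ?\<Psi> (v(k := a)))"
    by (rule definable_pred_Exists [OF insert.IH])
  moreover have "(\<exists>a\<in>carrier G. ?\<Psi> (v(k := a))) \<longleftrightarrow>
    (\<exists>u. range u \<subseteq> carrier G \<and> (\<forall>i. i \<notin> insert k I \<longrightarrow> u i = v i) \<and> \<Phi> u)" for v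
  proof
    assume "\<exists>u. range u \<subseteq> carrier G \<and> (\<forall>i. i \<notin> insert k I \<longrightarrow> u i = v i) \<and> \<Phi> u"
    then obtain u where u: "range u \<subseteq> carrier G" "\<And>i. i \<notin> insert k I \<Longrightarrow> u i = v i" "\<Phi> u" by blast
    then show "\<exists>a\<in>carrier G. ?\<Psi> (v(k := a))"
      by (intro bexI [of _ "u k"] exI [of _ u]) auto
  next
    assume "\<exists>a\<in>carrier G. ?\<Psi> (v(k := a))"
    then obtain a u where "range u \<subseteq> carrier G" "\<forall>i. i \<notin> I \<longrightarrow> u i = (v(k := a)) i" "\<Phi> u" by blast
    then show "\<exists>u. range u \<subseteq> carrier G \<and> (\<forall>i. i \<notin> insert k I \<longrightarrow> u i = v i) \<and> \<Phi> u"
      by (intro exI [of _ u]) auto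
  qed
  ultimately show ?case by simp
qed

lemma definable_pred_parameter:
  assumes "definable_pred G \<Phi>" "s \<in> carrier G"
  shows "definable_pred G (\<lambda>v. \<Phi> (v(k := s)))"
proof -
  obtain p e where p: "wf_formula G p" "range e \<subseteq> carrier G"
    "\<And>v. range v \<subseteq> carrier G \<Longrightarrow> \<Phi> v = sat G (interleave v e) p"
    using assms(1) unfolding definable_pred_def by blast
  \<comment> \<open>Variable \<open>2 * k\<close> is redirected to the new first parameter slot, and
    the old parameters each move up by one slot to make room.\<close>
  define g where "g i = (if i = 2 * k then 1 else if even i then i else i + 2)" for i
  define e' where "e' = case_nat s e"
  have inj: "inj g" by (auto simp: inj_def g_def split: if_splits)
  have "interleave v e' \<circ> g = interleave (v(k := s)) e" for v
  proof (rule interleave_eqI)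
    fix i
    show "(interleave v e' \<circ> g) (2 * i) = (v(k := s)) i"
      by (simp add: g_def) (simp add: interleave_def e'_def)
    have "g (Suc (2 * i)) = Suc (2 * Suc i)" by (simp add: g_def Suc_double_not_eq_double)
    then show "(interleave v e' \<circ> g) (Suc (2 * i)) = e i"
      by (simp del: mult_Suc_right) (simp add: e'_def)
  qed
  moreover have "range e' \<subseteq> carrier G"
  proof clarify
    show "e' i \<in> carrier G" for i using p(2) assms(2) by (cases i) (auto simp: e'_def)
  qed
  moreover have "range (v(k := s)) \<subseteq> carrier G" if "range v \<subseteq> carrier G" for v
    using that assms(2) by auto
  ultimately show ?thesis
    unfolding definable_pred_def using p inj
    by (intro exI [of _ "rename_formula g p"] exI [of _ e']) (simp add: sat_rename_formula)
qed

lemma definable_pred_mem: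
  assumes "definable G B" "wf_term G t"
  shows "definable_pred G (\<lambda>v. eval_term G v t \<in> B)"
proof -
  obtain p e where p: "wf_formula G p" "range e \<subseteq> carrier G"
    "B = {x \<in> carrier G. sat G (e(0 := x)) p}"
    using assms(1) unfolding definable_def by blast
  \<comment> \<open>All variables of \<open>p\<close> move to odd positions, where index
    \<open>k\<close> reads the parameter \<open>e k\<close>. Position 1, the slot of the overwritten
    value \<open>e 0\<close>, becomes the bound variable holding the value of
    \<open>t\<close>.\<close>
  define g where "g k = Suc (2 * k)" for k :: nat
  have inj: "inj g" by (auto simp: inj_def g_def)
  let ?q = "Exists 1 (Conj (Equal (Var 1) (rename_term (\<lambda>i. 2 * i) t)) (rename_formula g p))"
  have "eval_term G v t \<in> B \<longleftrightarrow> sat G (interleave v e) ?q" if v: "range v \<subseteq> carrier G" for v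
  proof -
    have 1: "(interleave v e)(1 := a) \<circ> g = e(0 := a)" for a
      by (auto simp: g_def fun_eq_iff)
    have 2: "(interleave v e)(1 := a) \<circ> (\<lambda>i. 2 * i) = v" for a
      by (auto simp: fun_eq_iff)
    have "sat G (interleave v e) ?q \<longleftrightarrow> (\<exists>a\<in>carrier G. a = eval_term G v t \<and> sat G (e(0 := a)) p)"
      using inj by (simp add: sat_rename_formula 1 [simplified] 2 [simplified])
    then show ?thesis using p(3) eval_term_closed [OF assms(2) v] by auto
  qed
  then show ?thesis
    unfolding definable_pred_def using p assms(2)
    by (intro exI [of _ ?q] exI [of _ e]) auto
qed

lemma definable_of_pred:
  assumes "definable_pred G \<Phi>"
  shows "definable G {x \<in> carrier G. \<Phi> ((\<lambda>_. \<one>)(0 := x))}"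
proof -
  obtain p e where p: "wf_formula G p" "range e \<subseteq> carrier G"
    "\<And>v. range v \<subseteq> carrier G \<Longrightarrow> \<Phi> v = sat G (interleave v e) p"
    using assms(1) unfolding definable_pred_def by blast
  let ?e = "interleave (\<lambda>_. \<one>) e"
  have "?e(0 := x) = interleave ((\<lambda>_. \<one>)(0 := x)) e" for x
    by (rule interleave_eqI) auto
  moreover have "range ((\<lambda>_. \<one>)(0 := x)) \<subseteq> carrier G" if "x \<in> carrier G" for x :: 'a
    using that by auto
  ultimately have "\<Phi> ((\<lambda>_. \<one>)(0 := x)) = sat G (?e(0 := x)) p" if "x \<in> carrier G" for x
    using that p(3) [of "(\<lambda>_. \<one>)(0 := x)"] by metis
  then have "{x \<in> carrier G. \<Phi> ((\<lambda>_. \<one>)(0 := x))} = {x \<in> carrier G. sat G (?e(0 := x)) p}" by blast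
  moreover have "range ?e \<subseteq> carrier G" using p(2) by (auto simp: interleave_def)
  ultimately show ?thesis unfolding definable_def using p(1) by blast
qed

lemma definable_one: "definable G {\<one>}"
  unfolding definable_def
  by (intro exI [of _ "Equal (Var 0) One"] exI [of _ "\<lambda>_. \<one>"]) auto

lemma definable_carrier: "definable G (carrier G)"
  unfolding definable_def
  by (intro exI [of _ "Equal One One"] exI [of _ "\<lambda>_. \<one>"]) auto

text \<open>By the tuple form, the index exceeds \<open>d\<close> exactly if \<open>d + 1\<close>
  elements centralizing \<open>S\<close> lie in distinct cosets of the centralizer of
  \<open>g\<close>. Variable 0 holds \<open>g\<close>, variables \<open>1\<close> to
  \<open>d + 1\<close> the tuple; the finitely many elements of \<open>S\<close> enter as
  parameters.\<close>

lemma definable_index_le: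
  assumes B: "definable G B" "B \<lhd> G" and S: "finite S" "S \<subseteq> carrier G"
  shows "definable G {g \<in> carrier G. index_le (cent S B) (cent {g} B) d}"
proof -
  define C where "C i u \<longleftrightarrow> (\<forall>s\<in>S. comm (u (Suc i)) s \<in> B)" for i and u :: "nat \<Rightarrow> 'a"
  define D where "D i j u \<longleftrightarrow> comm (inv (u (Suc i)) \<otimes> u (Suc j)) (u 0) \<in> B" for i j and u :: "nat \<Rightarrow> 'a"
  define \<Phi> where "\<Phi> u \<longleftrightarrow> (\<forall>i\<in>{..d}. C i u) \<and> (\<forall>i\<in>{..d}. \<forall>j\<in>{..d}-{i}. \<not> D i j u)" for u
  define comm_term :: "'f fo_term \<Rightarrow> 'f fo_term \<Rightarrow> 'f fo_term"
    where "comm_term s t = Times (Times (Times s t) (Inverse s)) (Inverse t)" for s t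
  have comm_term: "eval_term G u (comm_term s t) = comm (eval_term G u s) (eval_term G u t)"
    "wf_term G (comm_term s t) \<longleftrightarrow> wf_term G s \<and> wf_term G t" for u s t
    by (auto simp: comm_term_def comm_def)
  have "definable_pred G (C i)" for i
    unfolding C_def
  proof (rule definable_pred_Ball [OF S(1)])
    fix s assume s: "s \<in> S"
    have "definable_pred G (\<lambda>u. comm (u (Suc i)) (u 0) \<in> B)"
      using definable_pred_mem [OF B(1), of "comm_term (Var (Suc i)) (Var 0)"] by (simp add: comm_term)
    from definable_pred_parameter [OF this, of s 0]
    show "definable_pred G (\<lambda>u. comm (u (Suc i)) s \<in> B)" using s S(2) by auto
  qed
  moreover have "definable_pred G (D i j)" for i j
    unfolding D_def
    using definable_pred_mem [OF B(1), of "comm_term (Times (Inverse (Var (Suc i))) (Var (Suc j))) (Var 0)"]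
    by (simp add: comm_term)
  ultimately have "definable_pred G \<Phi>"
    unfolding \<Phi>_def by (intro definable_pred_Conj definable_pred_Ball definable_pred_Neg) auto
  then have "definable_pred G (\<lambda>v. \<not> (\<exists>u. range u \<subseteq> carrier G \<and> (\<forall>i. i \<notin> Suc ` {..d} \<longrightarrow> u i = v i) \<and> \<Phi> u))"
    by (intro definable_pred_Neg definable_pred_Exists_finite) auto
  note def = definable_of_pred [OF this]
  have "index_le (cent S B) (cent {g} B) d \<longleftrightarrow>
    \<not> (\<exists>u. range u \<subseteq> carrier G \<and> (\<forall>i. i \<notin> Suc ` {..d} \<longrightarrow> u i = ((\<lambda>_. \<one>)(0 := g)) i) \<and> \<Phi> u)"
    (is "_ \<longleftrightarrow> \<not> ?R") if g: "g \<in> carrier G" for g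
  proof
    assume idx: "index_le (cent S B) (cent {g} B) d"
    show "\<not> ?R"
    proof
      assume ?R
      then obtain u where u: "range u \<subseteq> carrier G" "\<And>i. i \<notin> Suc ` {..d} \<Longrightarrow> u i = ((\<lambda>_. \<one>)(0 := g)) i" "\<Phi> u"
        by blast
      have "(\<lambda>i. u (Suc i)) ` {..d} \<subseteq> cent S B"
        using u by (auto simp: \<Phi>_def C_def intro!: centI)
      then obtain i j where "i \<le> d" "j \<le> d" "i \<noteq> j" "inv (u (Suc i)) \<otimes> u (Suc j) \<in> cent {g} B"
        using index_le_tupleD [OF idx] by blast
      moreover have "u 0 = g" using u(2) [of 0] by auto
      ultimately have "D i j u" "\<not> D i j u"
        using u(3) centD [of "inv (u (Suc i)) \<otimes> u (Suc j)" "{g}" B g] by (auto simp: \<Phi>_def D_def)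
      then show False by blast
    qed
  next
    assume nR: "\<not> ?R"
    show "index_le (cent S B) (cent {g} B) d"
    proof (rule ccontr)
      assume n: "\<not> index_le (cent S B) (cent {g} B) d"
      have "subgroup (cent {g} B) G" using cent_subgroup [OF B(2)] g by simp
      then obtain r :: "nat \<Rightarrow> 'a" where r: "r ` {..d} \<subseteq> cent S B"
        "\<And>i j. i \<le> d \<Longrightarrow> j \<le> d \<Longrightarrow> i \<noteq> j \<Longrightarrow> inv (r i) \<otimes> r j \<notin> cent {g} B"
        by (rule index_le_tupleI [OF _ cent_subset n]) blast
      define u where "u = case_nat g (\<lambda>i. if i \<le> d then r i else \<one>)"
      have rc: "r i \<in> carrier G" if "i \<le> d" for i using that r(1) cent_closed by blast
      have "range u \<subseteq> carrier G" using rc g by (auto simp: u_def split: nat.splits)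
      moreover have "\<forall>i. i \<notin> Suc ` {..d} \<longrightarrow> u i = ((\<lambda>_. \<one>)(0 := g)) i"
        by (auto simp: u_def image_iff split: nat.splits)
      moreover have "\<Phi> u"
        unfolding \<Phi>_def
      proof (intro conjI ballI)
        show "C i u" if "i \<in> {..d}" for i using that r(1) centD by (auto simp: C_def u_def)
        show "\<not> D i j u" if "i \<in> {..d}" "j \<in> {..d} - {i}" for i j
          using that r(2) [of i j] rc by (auto simp: D_def u_def cent_def)
      qed
      ultimately have ?R by blast
      then show False using nR by blast
    qed
  qed
  then have "{g \<in> carrier G. index_le (cent S B) (cent {g} B) d} = {x \<in> carrier G.
    \<not> (\<exists>u. range u \<subseteq> carrier G \<and> (\<forall>i. i \<notin> Suc ` {..d} \<longrightarrow> u i = ((\<lambda>_. \<one>)(0 := x)) i) \<and> \<Phi> u)}"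
    by blast
  then show ?thesis using def by simp
qed

end

section \<open>The chain condition modulo a definable normal subgroup\<close>

lemma (in group) normal_carrier_subset_normalizer:
  assumes "B \<lhd> G"
  shows "carrier G \<subseteq> normalizer G B"
proof
  fix g assume g: "g \<in> carrier G"
  have sub: "B \<subseteq> carrier G" by (rule normal_subset [OF assms])
  have "g <# B #> inv g = B #> g #> inv g" using normal.coset_eq [OF assms] g by simp
  also have "\<dots> = B" using sub g by (simp add: coset_mult_assoc)
  finally show "g \<in> normalizer G B" using g sub by (simp add: normalizer_def stabilizer_def)
qed

text \<open>If there were fewer than \<open>d\<close> cosets in the quotient, they would provide a
  colouring in \<open>G\<close> proving the excluded bound.\<close>

lemma (in group) index_at_least_quotient_centralizer:
  assumes B: "B \<lhd> G" and g: "\<And>j. j \<le> Suc i \<Longrightarrow> g j \<in> carrier G"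
    and "\<not> index_le (cent (g ` {..i}) B) (cent {g (Suc i)} B) d"
  shows "index_at_least (G Mod B) (centralizer (G Mod B) ((\<lambda>j. B #> g j) ` {..i}))
    (centralizer (G Mod B) ((\<lambda>j. B #> g j) ` {..Suc i})) d"
proof (rule ccontr)
  interpret q: group_hom G "G Mod B" "\<lambda>x. B #> x" using B by (rule quotient_hom)
  let ?Q = "G Mod B"
  let ?C = "\<lambda>i. centralizer ?Q ((\<lambda>j. B #> g j) ` {..i})"
  let ?cosets = "rcosets\<^bsub>?Q\<lparr>carrier := ?C i\<rparr>\<^esub> ?C (Suc i)"
  \<comment> \<open>The inverse reconciles two conventions: \<open>index_le\<close> compares left
    cosets, while the cosets counted in the quotient are right cosets.\<close>
  define \<psi> where "\<psi> a = ?C (Suc i) #>\<^bsub>?Q\<^esub> (B #> inv a)" for a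
  assume "\<not> index_at_least ?Q (?C i) (?C (Suc i)) d"
  then have fin: "finite ?cosets" and card: "card ?cosets < d"
    by (simp_all add: index_at_least_def Let_def)
  let ?A = "cent (g ` {..i}) B"
  have mem: "B #> a \<in> ?C i" if "a \<in> ?A" for a
    using that g comm_in_iff [OF B, of a] by (auto simp: centralizer_def cent_def)
  have sub: "subgroup ?A G" using g by (intro cent_subgroup B) auto
  have cos: "\<psi> ` ?A \<subseteq> ?cosets"
  proof clarify
    fix a assume "a \<in> ?A"
    then have "B #> inv a \<in> ?C i" using mem subgroup.m_inv_closed [OF sub] by blast
    then show "\<psi> a \<in> ?cosets" by (auto simp: \<psi>_def RCOSETS_def r_coset_def)
  qed
  have "index_le ?A (cent {g (Suc i)} B) d"
  proof (rule index_leI [where \<psi> = \<psi>])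
    show "finite (\<psi> ` ?A)" using finite_subset [OF cos fin] .
    show "card (\<psi> ` ?A) \<le> d" using card_mono [OF fin cos] card by simp
    fix a b assume ab: "a \<in> ?A" "b \<in> ?A" "\<psi> a = \<psi> b"
    have c: "a \<in> carrier G" "b \<in> carrier G" using ab cent_closed by blast+
    have "\<one>\<^bsub>?Q\<^esub> \<in> ?C (Suc i)" using g by (auto simp: centralizer_def simp del: mult_FactGroup one_FactGroup)
    then have "\<one>\<^bsub>?Q\<^esub> \<otimes>\<^bsub>?Q\<^esub> (B #> inv a) \<in> \<psi> a" unfolding \<psi>_def r_coset_def by blast
    then have "B #> inv a \<in> \<psi> b" using ab c by (simp del: mult_FactGroup one_FactGroup)
    then obtain h where h: "h \<in> ?C (Suc i)" "B #> inv a = h \<otimes>\<^bsub>?Q\<^esub> (B #> inv b)"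
      unfolding \<psi>_def r_coset_def by blast
    have hc: "h \<in> carrier ?Q" using h(1) by (simp add: centralizer_def)
    have "B #> (inv a \<otimes> b) = (B #> inv a) \<otimes>\<^bsub>?Q\<^esub> (B #> b)" using c by (intro q.hom_mult) auto
    also have "\<dots> = h \<otimes>\<^bsub>?Q\<^esub> (inv\<^bsub>?Q\<^esub> (B #> b) \<otimes>\<^bsub>?Q\<^esub> (B #> b))"
      using h(2) hc c by (simp add: q.H.m_assoc del: mult_FactGroup)
    also have "\<dots> = h" using hc c by (simp del: mult_FactGroup one_FactGroup)
    finally have "B #> (inv a \<otimes> b) \<in> ?C (Suc i)" using h(1) by simp
    then have eq: "(B #> (inv a \<otimes> b)) \<otimes>\<^bsub>?Q\<^esub> (B #> g (Suc i)) = (B #> g (Suc i)) \<otimes>\<^bsub>?Q\<^esub> (B #> (inv a \<otimes> b))"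
      unfolding centralizer_def by blast
    then have "comm (inv a \<otimes> b) (g (Suc i)) \<in> B"
      using comm_in_iff [OF B, of "inv a \<otimes> b" "g (Suc i)"] c g by simp
    then show "inv a \<otimes> b \<in> cent {g (Suc i)} B" using c by (auto intro!: centI)
  qed
  then show False using assms(3) by blast
qed

text \<open>The chain condition for \<open>H = G\<close> and \<open>N = B\<close>. If no finite
  subset of \<open>S\<close> sufficed, a further element could always be appended whose centralizer
  cuts the current one in index at least \<open>d\<close>, giving a chain with \<open>n + 1\<close>
  steps.\<close>

lemma mc_tilde_chain:
  fixes G :: "('a, 'f, 'r) expanded_group" (structure)
  assumes "mc_tilde_group G" "definable G B" "B \<lhd> G"
  shows "\<exists>d. \<forall>S\<subseteq>carrier G. \<exists>S0\<subseteq>S. finite S0 \<and>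
    (\<forall>g\<in>S. group.index_le G (group.cent G S0 B) (group.cent G {g} B) d)"
proof -
  interpret expanded_group G using assms(1) by (simp add: mc_tilde_group_def)
  have GB: "G\<lparr>carrier := carrier G\<rparr> = G" "carrier G \<inter> B = B" using normal_subset [OF assms(3)] by auto
  have "subgroup (carrier G) G \<and> definable G (carrier G) \<and> subgroup B G \<and> definable G B \<and>
      carrier G \<subseteq> normalizer G B"
    using assms(2) subgroup_self definable_carrier normal_imp_subgroup [OF assms(3)]
      normal_carrier_subset_normalizer [OF assms(3)] by blast
  from assms(1) [unfolded mc_tilde_group_def, THEN conjunct2, THEN spec, THEN spec, THEN mp, OF this]
  obtain n d where "\<forall>m g. g ` {..m} \<subseteq> carrier G \<and>
      (\<forall>i<m. index_at_least (G Mod B)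
        (centralizer (G Mod B) ((\<lambda>j. B #> g j) ` {..i}))
        (centralizer (G Mod B) ((\<lambda>j. B #> g j) ` {..Suc i})) d) \<longrightarrow> m \<le> n"
    unfolding quotient_centralizer_def GB by blast
  then have nd: "m \<le> n" if "g ` {..m} \<subseteq> carrier G"
      "\<And>i. i < m \<Longrightarrow> index_at_least (G Mod B)
        (centralizer (G Mod B) ((\<lambda>j. B #> g j) ` {..i}))
        (centralizer (G Mod B) ((\<lambda>j. B #> g j) ` {..Suc i})) d" for m g
    using that by blast
  have "\<exists>S0\<subseteq>S. finite S0 \<and> (\<forall>g\<in>S. index_le (cent S0 B) (cent {g} B) d)" if S: "S \<subseteq> carrier G" for S
  proof (rule ccontr)
    assume "\<not> ?thesis"
    then have ext: "\<exists>g\<in>S. \<not> index_le (cent S0 B) (cent {g} B) d" if "finite S0" "S0 \<subseteq> S" for S0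
      using that by blast
    have "\<exists>g. g ` {..m} \<subseteq> S \<and> (\<forall>i<m. \<not> index_le (cent (g ` {..i}) B) (cent {g (Suc i)} B) d)" for m
    proof (induction m)
      case 0
      obtain a where "a \<in> S" using ext [of "{}"] by blast
      then show ?case by (intro exI [of _ "\<lambda>_. a"]) auto
    next
      case (Suc m)
      then obtain g where g: "g ` {..m} \<subseteq> S"
        "\<And>i. i < m \<Longrightarrow> \<not> index_le (cent (g ` {..i}) B) (cent {g (Suc i)} B) d" by blast
      obtain a where a: "a \<in> S" "\<not> index_le (cent (g ` {..m}) B) (cent {a} B) d"
        using ext [OF _ g(1)] by blast
      let ?g = "g(Suc m := a)"
      have im: "?g ` {..i} = g ` {..i}" if "i \<le> m" for i using that by (intro image_cong) auto
      have "?g ` {..Suc m} \<subseteq> S" using g(1) a(1) im [of m] by (auto simp: atMost_Suc)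
      moreover have "\<not> index_le (cent (?g ` {..i}) B) (cent {?g (Suc i)} B) d" if "i < Suc m" for i
        using that g(2) a(2) im [of i] by (cases "i = m") auto
      ultimately show ?case by blast
    qed
    then obtain g where g: "g ` {..Suc n} \<subseteq> S"
      "\<And>i. i < Suc n \<Longrightarrow> \<not> index_le (cent (g ` {..i}) B) (cent {g (Suc i)} B) d" by blast
    have "Suc n \<le> n"
    proof (rule nd)
      show "g ` {..Suc n} \<subseteq> carrier G" using g(1) S by blast
      fix i assume i: "i < Suc n"
      show "index_at_least (G Mod B) (centralizer (G Mod B) ((\<lambda>j. B #> g j) ` {..i}))
        (centralizer (G Mod B) ((\<lambda>j. B #> g j) ` {..Suc i})) d"
      proof (rule index_at_least_quotient_centralizer [OF assms(3) _ g(2) [OF i]])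
        fix j assume "j \<le> Suc i"
        then have "g j \<in> g ` {..Suc n}" using i by auto
        then show "g j \<in> carrier G" using g(1) S by blast
      qed
    qed
    then show False by simp
  qed
  then show ?thesis by blast
qed

theorem theorem4p4:
  fixes G :: "('a, 'f, 'r) expanded_group"
  assumes "mc_tilde_group G"
  shows "nilpotent_group (G\<lparr>carrier := fitting_subgroup G\<rparr>)"
proof -
  interpret expanded_group G using assms by (simp add: mc_tilde_group_def)
  interpret almost_centralizer_group G "fitting_subgroup G" "definable G"
  proof (intro almost_centralizer_group.intro almost_centralizer_group_axioms.intro)
    show "fitting_subgroup G \<lhd> G" by (rule fitting_subgroup_normal)
  qed (fact group_axioms fitting_subgroup_local definable_one definable_index_le mc_tilde_chain [OF assms])+
  show ?thesis using nilpotent_of_up [OF F_normal] F_hypercentral by blast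
qed

end
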